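(* Let $n\geq 3$, let $g_0$ be the standard Euclidean metric on $\mathbb{R}^n$, and let $g$ be a complete Riemannian metric on $\mathbb{R}^n$ which is conformal to $g_0$. Suppose that $A^{\tau}_g\geq 0$ everywhere on $\mathbb{R}^n$ for some $\tau\in\left(0,\frac{2(n-1)}{n}\right)$. Then $(\mathbb{R}^n,g)$ is isometric to $(\mathbb{R}^n,g_0)$.
   Context: Metrics are smooth. A metric $g$ is conformal to $g_0$ if $g=e^{2f}g_0$ for some smooth function $f$. For a Riemannian metric $g$ on an $n$-manifold with Ricci tensor $Ric$ and scalar curvature $R$, and for $\tau>0$, the modified Schouten tensor is the symmetric $(0,2)$-tensor $$A^{\tau}_g=Ric-\frac{\tau R}{2(n-1)}\,g.$$ The inequality $A^{\tau}_g\geq 0$ means that this symmetric bilinear form is positive semidefinite at each point. *)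

theory Defs
  imports "HOL-Analysis.Analysis"
begin

section \<open>Smooth maps between Euclidean spaces\<close>

text \<open>
  \<open>Ck k f\<close>: all iterated directional derivatives of \<open>f\<close> of order at most \<open>k\<close> exist
  and are continuous.
\<close>

primrec Ck :: "nat \<Rightarrow> ('a::euclidean_space \<Rightarrow> 'b::real_normed_vector) \<Rightarrow> bool" where
  "Ck 0 f \<longleftrightarrow> continuous_on UNIV f"
| "Ck (Suc k) f \<longleftrightarrow>
     (\<forall>x. f differentiable (at x)) \<and> (\<forall>v. Ck k (\<lambda>x. frechet_derivative f (at x) v))"

definition smooth :: "('a::euclidean_space \<Rightarrow> 'b::real_normed_vector) \<Rightarrow> bool" where
  "smooth f \<longleftrightarrow> (\<forall>k. Ck k f)"

section \<open>Riemannian metrics in the global chart of \<open>\<real>\<^sup>n\<close>\<close>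

text \<open>
  A metric on \<open>\<real>\<^sup>n\<close> is given by its Gram matrix with respect to the coordinate frame, so
  \<open>g x $ i $ j\<close> is the value of the metric at \<open>x\<close> on the \<open>i\<close>-th and \<open>j\<close>-th
  coordinate vector fields.
\<close>

type_synonym 'n metric_field = "real^'n \<Rightarrow> real^'n^'n"

definition riemannian_metric :: "'n::finite metric_field \<Rightarrow> bool" where
  "riemannian_metric g \<longleftrightarrow>
     smooth g \<and> (\<forall>x. transpose (g x) = g x) \<and> (\<forall>x v. v \<noteq> 0 \<longrightarrow> v \<bullet> (g x *v v) > 0)"

definition std_metric :: "'n::finite metric_field" where
  "std_metric x = mat 1"

definition conformal_to :: "'n::finite metric_field \<Rightarrow> 'n metric_field \<Rightarrow> bool" where
  "conformal_to g h \<longleftrightarrow>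
     (\<exists>f :: real^'n \<Rightarrow> real. smooth f \<and> (\<forall>x. g x = exp (2 * f x) *\<^sub>R h x))"

section \<open>Completeness\<close>

definition curve_speed :: "'n::finite metric_field \<Rightarrow> (real \<Rightarrow> real^'n) \<Rightarrow> real \<Rightarrow> real" where
  "curve_speed g \<gamma> t =
     sqrt (vector_derivative \<gamma> (at t) \<bullet> (g (\<gamma> t) *v vector_derivative \<gamma> (at t)))"

definition curve_length :: "'n::finite metric_field \<Rightarrow> (real \<Rightarrow> real^'n) \<Rightarrow> real" where
  "curve_length g \<gamma> = integral {0..1} (curve_speed g \<gamma>)"

text \<open>
  The library's \<^const>\<open>valid_path\<close> (continuous, and \<open>C\<^sup>1\<close> off a finite set) allows the
  derivative to blow up at the exceptional points. Integrability of the speed is therefore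
  required, since the integral of a curve of infinite length would otherwise be \<open>0\<close>.
\<close>

definition riemannian_dist :: "'n::finite metric_field \<Rightarrow> real^'n \<Rightarrow> real^'n \<Rightarrow> real" where
  "riemannian_dist g x y =
     Inf {curve_length g \<gamma> | \<gamma>. valid_path \<gamma> \<and> pathstart \<gamma> = x \<and> pathfinish \<gamma> = y \<and>
                                  curve_speed g \<gamma> integrable_on {0..1}}"

definition complete_metric :: "'n::finite metric_field \<Rightarrow> bool" where
  "complete_metric g \<longleftrightarrow>
     (\<forall>\<sigma> :: nat \<Rightarrow> real^'n.
        (\<forall>\<epsilon>>0. \<exists>N. \<forall>m\<ge>N. \<forall>k\<ge>N. riemannian_dist g (\<sigma> m) (\<sigma> k) < \<epsilon>) \<longrightarrow>
        (\<exists>x. (\<lambda>k. riemannian_dist g (\<sigma> k) x) \<longlonglongrightarrow> 0))"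

section \<open>Curvature\<close>

definition partial_deriv :: "'n::finite \<Rightarrow> (real^'n \<Rightarrow> real) \<Rightarrow> real^'n \<Rightarrow> real" where
  "partial_deriv i f x = frechet_derivative f (at x) (axis i 1)"

text \<open>\<open>christoffel g k i j\<close> is the symbol with upper index \<open>k\<close> of the Levi-Civita connection.\<close>

definition christoffel :: "'n::finite metric_field \<Rightarrow> 'n \<Rightarrow> 'n \<Rightarrow> 'n \<Rightarrow> real^'n \<Rightarrow> real" where
  "christoffel g k i j x =
     (1/2) * (\<Sum>l\<in>UNIV. matrix_inv (g x) $ k $ l *
        (partial_deriv i (\<lambda>y. g y $ j $ l) x + partial_deriv j (\<lambda>y. g y $ i $ l) x
         - partial_deriv l (\<lambda>y. g y $ i $ j) x))"

text \<open>
  \<open>riemann g l k i j\<close> is the \<open>l\<close>-th component of \<open>R(\<partial>\<^sub>i, \<partial>\<^sub>j) \<partial>\<^sub>k\<close>, where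
  \<open>R(X, Y) Z = \<nabla>\<^sub>X \<nabla>\<^sub>Y Z - \<nabla>\<^sub>Y \<nabla>\<^sub>X Z - \<nabla>\<^bsub>[X,Y]\<^esub> Z\<close>; the Ricci tensor is
  \<open>Ric(Y, Z) = tr (X \<mapsto> R(X, Y) Z)\<close>, so round spheres have positive Ricci curvature.
\<close>

definition riemann :: "'n::finite metric_field \<Rightarrow> 'n \<Rightarrow> 'n \<Rightarrow> 'n \<Rightarrow> 'n \<Rightarrow> real^'n \<Rightarrow> real" where
  "riemann g l k i j x =
     partial_deriv i (christoffel g l j k) x - partial_deriv j (christoffel g l i k) x
     + (\<Sum>m\<in>UNIV. christoffel g m j k x * christoffel g l i m x
                  - christoffel g m i k x * christoffel g l j m x)"

definition ricci :: "'n::finite metric_field \<Rightarrow> real^'n \<Rightarrow> real^'n^'n" where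
  "ricci g x = (\<chi> j k. \<Sum>i\<in>UNIV. riemann g i k i j x)"

definition scalar_curvature :: "'n::finite metric_field \<Rightarrow> real^'n \<Rightarrow> real" where
  "scalar_curvature g x = (\<Sum>i\<in>UNIV. \<Sum>j\<in>UNIV. matrix_inv (g x) $ i $ j * ricci g x $ i $ j)"

definition modified_schouten :: "real \<Rightarrow> 'n::finite metric_field \<Rightarrow> real^'n \<Rightarrow> real^'n^'n" where
  "modified_schouten \<tau> g x =
     ricci g x - (\<tau> * scalar_curvature g x / (2 * (real CARD('n) - 1))) *\<^sub>R g x"

text \<open>Symmetry is not demanded here: it is automatic for the tensors above.\<close>

definition pos_semidef :: "real^'n^'n::finite \<Rightarrow> bool" where
  "pos_semidef A \<longleftrightarrow> (\<forall>v. v \<bullet> (A *v v) \<ge> 0)"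

section \<open>Isometry\<close>

definition diffeomorphism :: "(real^'n::finite \<Rightarrow> real^'n) \<Rightarrow> bool" where
  "diffeomorphism \<phi> \<longleftrightarrow> bij \<phi> \<and> smooth \<phi> \<and> smooth (inv \<phi>)"

definition isometric :: "'n::finite metric_field \<Rightarrow> 'n metric_field \<Rightarrow> bool" where
  "isometric g h \<longleftrightarrow>
     (\<exists>\<phi>. diffeomorphism \<phi> \<and>
        (\<forall>x u v. frechet_derivative \<phi> (at x) u \<bullet> (h (\<phi> x) *v frechet_derivative \<phi> (at x) v)
                 = u \<bullet> (g x *v v)))"

end

theory Submission
  imports Defs
begin

text \<open>
  Write \<open>g = e\<^sup>2\<^sup>f g\<^sub>0\<close>, and let subscripts \<open>e\<close> denote derivatives in the direction of a Euclidean unit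
  vector \<open>e\<close>. The hypothesis \<open>A\<^sup>\<tau> \<ge> 0\<close> becomes
  \<open>(n - 2) (f\<^sub>e\<^sub>e - f\<^sub>e\<^sup>2) + (1 - \<tau>) \<Delta>f + (n - 2) (1 - \<tau>/2) |\<nabla>f|\<^sup>2 \<le> 0\<close> for every \<open>e\<close>
  (\<open>modified_schouten_quadratic_form\<close>). Summing over an orthonormal basis, the bound on \<open>\<tau>\<close> is exactly
  what yields \<open>\<Delta>f \<le> - (n - 2)/2 |\<nabla>f|\<^sup>2\<close>, that is, nonnegative scalar curvature. In particular the
  condition for \<open>\<tau>\<close> implies the one for every smaller positive value, so \<open>\<tau> < 1\<close> may be assumed.
  The aim is to show that a nonconstant \<open>f\<close> makes \<open>g\<close> incomplete, by finding a ray to infinity of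
  finite \<open>g\<close>-length; its length is an integral of \<open>e\<^sup>f\<close>. Two different consequences of the
  hypothesis are combined.

  First, the full pinching condition makes \<open>e\<close> to the power \<open>- \<alpha> f\<close>, for a suitable \<open>\<alpha> > 0\<close>, a
  subsolution of the operator \<open>v \<mapsto> (n - 2) \<lambda> + (1 - \<tau>) \<Delta>v\<close>, where \<open>\<lambda>\<close> is the least eigenvalue of the
  Hessian. This operator is so strongly weighted towards \<open>\<lambda>\<close> that it has a positive power of \<open>|x|\<close>,
  vanishing at the origin, among its solutions: the exponent is \<open>2 \<alpha>\<close>. Any smaller positive exponent gives a
  strict supersolution, and comparison on a punctured ball shows that a nonconstant subsolution must grow
  at least like such a power (\<open>growth_of_subsolution\<close>). Hence, for large \<open>t\<close>, the minimum of \<open>e\<^sup>f\<close> over the sphere of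
  radius \<open>t\<close> is at most a constant times \<open>t powr (-3/2)\<close> (\<open>conformal_factor_decay\<close>).

  Second, nonnegativity of the scalar curvature makes \<open>P = e\<^bsup>f/4\<^esup>\<close> superharmonic with room to spare:
  \<open>\<Delta>P \<le> - P |\<nabla>f|\<^sup>2 / 16\<close>. The mean value inequality and an energy estimate then bound the integral of
  \<open>P (1 + |\<nabla>f|\<^sup>2)\<close> over a ball by the value of \<open>P\<close> at any one point of the boundary sphere
  (\<open>weak_Harnack_unit_ball\<close>). Rescaled to radius \<open>t\<close> and applied at the point where the first
  part makes \<open>P\<close> small, this controls \<open>P\<close> and its radial derivative on average over all rays.
  By Tonelli's theorem some ray has finite weighted integrals of both, and in one variable this gives
  a pointwise bound \<open>e\<^sup>f \<le> K t powr (-5/4)\<close> (\<open>exists_thin_ray\<close>). The derivative is needed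
  because \<open>e\<^sup>f\<close> itself need not be superharmonic when \<open>n = 3\<close>, so that an average of
  \<open>P\<close> alone does not bound the length.

  Such a ray yields a Cauchy sequence that leaves every compact set (\<open>short_ray_not_complete\<close>),
  so \<open>f\<close> is constant for complete \<open>g\<close>, and a dilation is the required isometry.
\<close>

section \<open>Directional derivatives of twice continuously differentiable functions\<close>

declare Ck.simps [simp del]

text \<open>
  The direction comes first, so that \<open>dderiv v f\<close> is again a function and directional derivatives
  can be iterated.
\<close>

definition dderiv :: "'a::euclidean_space \<Rightarrow> ('a \<Rightarrow> real) \<Rightarrow> 'a \<Rightarrow> real" where
  "dderiv v f x = frechet_derivative f (at x) v"

definition grad :: "('a::euclidean_space \<Rightarrow> real) \<Rightarrow> 'a \<Rightarrow> 'a" where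
  "grad f x = (\<Sum>b\<in>Basis. dderiv b f x *\<^sub>R b)"

definition laplacian :: "('a::euclidean_space \<Rightarrow> real) \<Rightarrow> 'a \<Rightarrow> real" where
  "laplacian f x = (\<Sum>b\<in>Basis. dderiv b (dderiv b f) x)"

abbreviation C2 :: "('a::euclidean_space \<Rightarrow> real) \<Rightarrow> bool" where
  "C2 \<equiv> Ck (Suc (Suc 0))"

lemma smooth_imp_C2: "smooth f \<Longrightarrow> C2 f"
  by (simp add: smooth_def)

lemma dderiv_eqI: "(f has_derivative f') (at x) \<Longrightarrow> dderiv v f x = f' v"
  unfolding dderiv_def by (metis frechet_derivative_at)

lemma C2_iff:
  "C2 f \<longleftrightarrow> (\<forall>x. f differentiable (at x)) \<and> (\<forall>v x. dderiv v f differentiable (at x)) \<and>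
     (\<forall>v w. continuous_on UNIV (dderiv w (dderiv v f)))"
  unfolding dderiv_def[abs_def] by (auto simp: Ck.simps)

lemma C2_has_derivative:
  assumes "C2 f"
  shows "(f has_derivative (\<lambda>v. dderiv v f x)) (at x)"
    and "(dderiv w f has_derivative (\<lambda>v. dderiv v (dderiv w f) x)) (at x)"
proof -
  have "frechet_derivative h (at x) = (\<lambda>v. dderiv v h x)" for h :: "'a \<Rightarrow> real"
    by (simp add: dderiv_def)
  then have works: "h differentiable (at x) \<Longrightarrow> (h has_derivative (\<lambda>v. dderiv v h x)) (at x)" for h :: "'a \<Rightarrow> real"
    using frechet_derivative_works[of h "at x"] by simp
  show "(f has_derivative (\<lambda>v. dderiv v f x)) (at x)"
    and "(dderiv w f has_derivative (\<lambda>v. dderiv v (dderiv w f) x)) (at x)"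
    using assms works unfolding C2_iff by blast+
qed

lemma has_derivative_grad:
  assumes "(f has_derivative (\<lambda>v. dderiv v f x)) (at x)"
  shows "dderiv v f x = grad f x \<bullet> v"
proof -
  have lin: "linear (\<lambda>v. dderiv v f x)" using assms has_derivative_linear by blast
  have "dderiv v f x = dderiv (\<Sum>b\<in>Basis. (v \<bullet> b) *\<^sub>R b) f x"
    by (simp add: euclidean_representation)
  also have "\<dots> = (\<Sum>b\<in>Basis. (v \<bullet> b) * dderiv b f x)"
    using linear_sum[OF lin, of "\<lambda>b. (v \<bullet> b) *\<^sub>R b" Basis] linear_scale[OF lin] by simp
  also have "\<dots> = grad f x \<bullet> v"
    by (simp add: grad_def inner_sum_left inner_commute[of v] mult.commute)
  finally show ?thesis .
qed

lemma C2_grad: "C2 f \<Longrightarrow> dderiv v f x = grad f x \<bullet> v"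
  using has_derivative_grad C2_has_derivative(1) by blast

lemma grad_inner_Basis: "b \<in> Basis \<Longrightarrow> grad f x \<bullet> b = dderiv b f x"
  by (simp add: grad_def inner_sum_left inner_Basis if_distrib sum.delta cong: if_cong)

lemma norm_grad_sq: "(norm (grad f x))\<^sup>2 = (\<Sum>b\<in>Basis. (dderiv b f x)\<^sup>2)"
  unfolding power2_norm_eq_inner
  by (subst euclidean_inner) (simp add: grad_inner_Basis power2_eq_square)

lemma C2_continuous:
  assumes "C2 f"
  shows "continuous_on UNIV f" "continuous_on UNIV (dderiv v f)"
    "continuous_on UNIV (dderiv w (dderiv v f))" "continuous_on UNIV (grad f)"
    "continuous_on UNIV (laplacian f)"
proof -
  show "continuous_on UNIV f"
    using assms by (simp add: C2_iff differentiable_imp_continuous_within continuous_on_eq_continuous_within)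
  show 1: "continuous_on UNIV (dderiv v f)" for v
    using assms by (simp add: C2_iff differentiable_imp_continuous_within continuous_on_eq_continuous_within)
  show 2: "continuous_on UNIV (dderiv w (dderiv v f))" for v w
    using assms by (simp add: C2_iff)
  show "continuous_on UNIV (grad f)"
    unfolding grad_def[abs_def] by (intro continuous_intros 1)
  show "continuous_on UNIV (laplacian f)"
    unfolding laplacian_def[abs_def] by (intro continuous_intros 2)
qed

lemma C2_I:
  assumes "\<And>x. (f has_derivative (\<lambda>v. f' v x)) (at x)"
    and "\<And>v x. (f' v has_derivative (\<lambda>w. f'' w v x)) (at x)"
    and "\<And>v w. continuous_on UNIV (f'' w v)"
  shows "C2 f" and "dderiv v f = f' v" and "dderiv w (dderiv v f) = f'' w v"
proof -
  show 1: "dderiv v f = f' v" for v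
    using assms(1) dderiv_eqI by blast
  show 2: "dderiv w (dderiv v f) = f'' w v" for v w
    unfolding 1 using assms(2) dderiv_eqI by blast
  show "C2 f" unfolding C2_iff
    unfolding 2 unfolding 1 using assms by (auto simp: differentiable_def)
qed

lemma
  fixes f :: "'a::euclidean_space \<Rightarrow> real"
  assumes "C2 f"
  shows C2_exp: "C2 (\<lambda>x. exp (c * f x))"
    and dderiv_exp: "dderiv v (\<lambda>x. exp (c * f x)) x = c * exp (c * f x) * dderiv v f x"
    and dderiv2_exp: "dderiv w (dderiv v (\<lambda>x. exp (c * f x))) x =
       exp (c * f x) * (c * dderiv w (dderiv v f) x + c\<^sup>2 * dderiv w f x * dderiv v f x)"
proof -
  note der [derivative_intros] = C2_has_derivative[OF assms]
  note cont [continuous_intros] = C2_continuous[OF assms]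
  have 1: "((\<lambda>x. exp (c * f x)) has_derivative (\<lambda>v. c * exp (c * f x) * dderiv v f x)) (at x)" for x
    by (auto intro!: derivative_eq_intros simp: algebra_simps)
  have 2: "((\<lambda>x. c * exp (c * f x) * dderiv v f x) has_derivative (\<lambda>w. exp (c * f x) * (c * dderiv w (dderiv v f) x + c\<^sup>2 * dderiv w f x * dderiv v f x))) (at x)" for x v
    by (rule derivative_eq_intros der refl | simp add: algebra_simps power2_eq_square)+
  have 3: "continuous_on UNIV (\<lambda>x. exp (c * f x) * (c * dderiv w (dderiv v f) x + c\<^sup>2 * dderiv w f x * dderiv v f x))" for v w
    by (intro continuous_intros cont)
  note I = C2_I[of "\<lambda>x. exp (c * f x)" "\<lambda>v x. c * exp (c * f x) * dderiv v f x", OF 1 2 3]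
  show "C2 (\<lambda>x. exp (c * f x))" by (rule I(1))
  show "dderiv v (\<lambda>x. exp (c * f x)) x = c * exp (c * f x) * dderiv v f x"
    by (simp add: I(2))
  show "dderiv w (dderiv v (\<lambda>x. exp (c * f x))) x =
       exp (c * f x) * (c * dderiv w (dderiv v f) x + c\<^sup>2 * dderiv w f x * dderiv v f x)"
    by (simp add: I(3))
qed

lemma grad_exp:
  assumes "C2 f" shows "grad (\<lambda>x. exp (c * f x)) x = (c * exp (c * f x)) *\<^sub>R grad f x"
  by (simp add: grad_def dderiv_exp[OF assms] scaleR_sum_right mult.assoc)

lemma laplacian_exp:
  assumes "C2 f"
  shows "laplacian (\<lambda>x. exp (c * f x)) x =
    exp (c * f x) * (c * laplacian f x + c\<^sup>2 * (norm (grad f x))\<^sup>2)"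
  unfolding laplacian_def norm_grad_sq dderiv2_exp[OF assms]
  by (simp add: sum_distrib_left sum.distrib algebra_simps power2_eq_square)

lemma
  fixes f :: "'a::euclidean_space \<Rightarrow> real"
  assumes "C2 f"
  shows C2_affine: "C2 (\<lambda>y. f (z + t *\<^sub>R y))"
    and dderiv_affine: "dderiv v (\<lambda>y. f (z + t *\<^sub>R y)) y = t * dderiv v f (z + t *\<^sub>R y)"
    and dderiv2_affine: "dderiv w (dderiv v (\<lambda>y. f (z + t *\<^sub>R y))) y =
       t\<^sup>2 * dderiv w (dderiv v f) (z + t *\<^sub>R y)"
proof -
  have aff: "((\<lambda>y. z + t *\<^sub>R y) has_derivative (\<lambda>v. t *\<^sub>R v)) (at y)" for y
    by (auto intro!: derivative_eq_intros)
  have 1: "((\<lambda>y. f (z + t *\<^sub>R y)) has_derivative (\<lambda>v. t * dderiv v f (z + t *\<^sub>R y))) (at y)" for y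
    using has_derivative_compose[OF aff C2_has_derivative(1)[OF assms]]
    by (simp add: C2_grad[OF assms])
  have lin: "linear (\<lambda>v. dderiv v (dderiv w f) x)" for w x
    using C2_has_derivative(2)[OF assms] has_derivative_linear by blast
  have 2: "((\<lambda>y. t * dderiv v f (z + t *\<^sub>R y)) has_derivative
      (\<lambda>w. t\<^sup>2 * dderiv w (dderiv v f) (z + t *\<^sub>R y))) (at y)" for y v
    using has_derivative_mult_right[OF has_derivative_compose[OF aff C2_has_derivative(2)[OF assms]], of t]
    by (simp add: linear_scale[OF lin] power2_eq_square mult.assoc)
  have 3: "continuous_on UNIV (\<lambda>y. t\<^sup>2 * dderiv w (dderiv v f) (z + t *\<^sub>R y))" for v w
    by (intro continuous_intros continuous_on_compose2[OF C2_continuous(3)[OF assms]]) auto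
  note I = C2_I[of "\<lambda>y. f (z + t *\<^sub>R y)" "\<lambda>v y. t * dderiv v f (z + t *\<^sub>R y)", OF 1 2 3]
  show "C2 (\<lambda>y. f (z + t *\<^sub>R y))" by (rule I(1))
  show "dderiv v (\<lambda>y. f (z + t *\<^sub>R y)) y = t * dderiv v f (z + t *\<^sub>R y)" by (simp add: I(2))
  show "dderiv w (dderiv v (\<lambda>y. f (z + t *\<^sub>R y))) y =
       t\<^sup>2 * dderiv w (dderiv v f) (z + t *\<^sub>R y)" by (simp add: I(3))
qed

lemma grad_affine:
  assumes "C2 f" shows "grad (\<lambda>y. f (z + t *\<^sub>R y)) y = t *\<^sub>R grad f (z + t *\<^sub>R y)"
  by (simp add: grad_def dderiv_affine[OF assms] scaleR_sum_right)

lemma laplacian_affine: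
  assumes "C2 f" shows "laplacian (\<lambda>y. f (z + t *\<^sub>R y)) y = t\<^sup>2 * laplacian f (z + t *\<^sub>R y)"
  by (simp add: laplacian_def dderiv2_affine[OF assms] sum_distrib_left)

lemma has_field_derivative_along_line:
  assumes "(f has_derivative (\<lambda>v. f' v)) (at (z + s *\<^sub>R e))"
  shows "((\<lambda>s. f (z + s *\<^sub>R e)) has_real_derivative f' e) (at s)"
proof -
  have aff: "((\<lambda>s. z + s *\<^sub>R e) has_derivative (\<lambda>h. h *\<^sub>R e)) (at s)"
    by (auto intro!: derivative_eq_intros)
  have lin: "linear f'" using assms has_derivative_linear by blast
  show ?thesis
    using has_derivative_compose[OF aff assms]
    by (simp add: has_field_derivative_def linear_scale[OF lin] mult.commute[of _ "f' e"] mult_commute_abs)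
qed

section \<open>Curvature of a conformally flat metric\<close>

lemma partial_deriv_eq: "partial_deriv i f = dderiv (axis i 1) f"
  by (auto simp: partial_deriv_def dderiv_def fun_eq_iff)

lemma bij_betw_axis_Basis: "bij_betw (\<lambda>i::'n::finite. axis i (1::real)) UNIV Basis"
  by (rule bij_betwI') (auto simp: axis_eq_axis Basis_vec_def)

lemma sum_Basis_axis: "(\<Sum>b\<in>(Basis :: (real^'n::finite) set). F b) = (\<Sum>i\<in>UNIV. F (axis i 1))"
  by (rule sum.reindex_bij_betw[OF bij_betw_axis_Basis, symmetric])

lemma matrix_inv_scaleR_mat_1:
  assumes "(c::real) \<noteq> 0"
  shows "matrix_inv (c *\<^sub>R mat 1 :: real^'n::finite^'n) = (1 / c) *\<^sub>R mat 1"
proof -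
  let ?A = "c *\<^sub>R mat 1 :: real^'n^'n"
  have scale: "(a *\<^sub>R mat 1) ** B = a *\<^sub>R B" for a and B :: "real^'n^'n"
    by (simp add: vec_eq_iff matrix_matrix_mult_def mat_def if_distrib if_distribR cong: if_cong)
  have "?A ** ((1 / c) *\<^sub>R mat 1) = mat 1" "((1 / c) *\<^sub>R mat 1) ** ?A = mat 1"
    using assms by (simp_all add: scale)
  then have "?A ** matrix_inv ?A = mat 1"
    unfolding matrix_inv_def
    by (rule someI2[of "\<lambda>B. ?A ** B = mat 1 \<and> B ** ?A = mat 1", OF conjI]) blast
  then have "c *\<^sub>R matrix_inv ?A = mat 1" by (simp only: scale)
  then have "(1 / c) *\<^sub>R (c *\<^sub>R matrix_inv ?A) = (1 / c) *\<^sub>R mat 1" by simp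
  then show ?thesis using assms by simp
qed

context
  fixes g :: "real^'n::finite \<Rightarrow> real^'n^'n" and f :: "real^'n \<Rightarrow> real"
  assumes C2: "C2 f" and g: "\<And>x. g x = exp (2 * f x) *\<^sub>R mat 1"
begin

abbreviation (input) "df i \<equiv> dderiv (axis i 1) f"

lemma conformal_entry: "g x $ i $ j = exp (2 * f x) * (if i = j then 1 else 0)"
  by (simp add: g mat_def)

lemma conformal_inv_entry: "matrix_inv (g x) $ i $ j = exp (- 2 * f x) * (if i = j then 1 else 0)"
  by (subst g, subst matrix_inv_scaleR_mat_1) (simp_all add: mat_def exp_minus inverse_eq_divide)

lemma partial_deriv_conformal:
  "partial_deriv k (\<lambda>y. g y $ i $ j) x = (if i = j then 2 * exp (2 * f x) * df k x else 0)"
proof (cases "i = j")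
  case True
  then show ?thesis using dderiv_exp[OF C2, of "axis k 1" 2]
    by (simp add: partial_deriv_eq conformal_entry)
next
  case False
  then show ?thesis
    by (simp add: partial_deriv_eq conformal_entry dderiv_eqI[OF has_derivative_const])
qed

lemma christoffel_conformal:
  "christoffel g k i j x = (if k = i then df j x else 0) + (if k = j then df i x else 0)
     - (if i = j then df k x else 0)"
proof -
  have "christoffel g k i j x = (1/2) * (exp (- 2 * f x) *
    (partial_deriv i (\<lambda>y. g y $ j $ k) x + partial_deriv j (\<lambda>y. g y $ i $ k) x
         - partial_deriv k (\<lambda>y. g y $ i $ j) x))"
    unfolding christoffel_def conformal_inv_entry
    by (simp add: if_distrib if_distribR cong: if_cong)
  also have "\<dots> = (1/2) * (exp (- 2 * f x) * (2 * exp (2 * f x))) *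
     ((if k = i then df j x else 0) + (if k = j then df i x else 0) - (if i = j then df k x else 0))"
    unfolding partial_deriv_conformal by (auto simp: algebra_simps)
  also have "(1/2) * (exp (- 2 * f x) * (2 * exp (2 * f x))) = 1" by (simp add: exp_minus)
  finally show ?thesis by simp
qed

lemma partial_deriv_christoffel:
  "partial_deriv l (christoffel g k i j) x =
     (if k = i then dderiv (axis l 1) (df j) x else 0) + (if k = j then dderiv (axis l 1) (df i) x else 0)
     - (if i = j then dderiv (axis l 1) (df k) x else 0)"
proof -
  have eq: "christoffel g k i j = (\<lambda>x. (if k = i then df j x else 0) + (if k = j then df i x else 0)
     - (if i = j then df k x else 0))"
    using christoffel_conformal by blast
  have sel: "((\<lambda>x. if b then df m x else 0) has_derivative (\<lambda>v. if b then dderiv v (df m) x else 0)) (at x)" for b m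
    using C2_has_derivative(2)[OF C2] by (cases b) auto
  show ?thesis unfolding partial_deriv_eq eq
    by (rule dderiv_eqI[OF has_derivative_diff[OF has_derivative_add[OF sel sel] sel]])
qed

text \<open>
  Both orders of the mixed second derivative occur. They contribute equally to the trace and to the
  quadratic form, and these are what enters the argument.
\<close>

lemma ricci_conformal:
  "ricci g x $ j $ k = dderiv (axis j 1) (df k) x + dderiv (axis k 1) (df j) x
     - real CARD('n) * dderiv (axis j 1) (df k) x
     + (real CARD('n) - 2) * (df j x * df k x)
     - (if j = k then laplacian f x + (real CARD('n) - 2) * (norm (grad f x))\<^sup>2 else 0)"
proof -
  \<comment> \<open>The components of the curvature are products of Kronecker deltas; written as factors \<open>?\<delta>\<close>
  they are contracted by the single rewrite rule \<open>d1\<close>.\<close>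
  let ?H = "\<lambda>l m. dderiv (axis l 1) (df m) x"
  let ?\<delta> = "\<lambda>a b. if a = b then 1 else (0::real)"
  have chr: "christoffel g k i j x = ?\<delta> k i * df j x + ?\<delta> k j * df i x - ?\<delta> i j * df k x" for k i j
    by (auto simp: christoffel_conformal)
  have pchr: "partial_deriv l (christoffel g k i j) x = ?\<delta> k i * ?H l j + ?\<delta> k j * ?H l i - ?\<delta> i j * ?H l k" for l k i j
    by (auto simp: partial_deriv_christoffel)
  have lap: "(\<Sum>i\<in>UNIV. ?H i i) = laplacian f x" by (simp add: laplacian_def sum_Basis_axis)
  have nrm: "(\<Sum>i\<in>UNIV. df i x * df i x) = (norm (grad f x))\<^sup>2"
    unfolding norm_grad_sq sum_Basis_axis by (simp add: power2_eq_square)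
  have d1: "(\<Sum>i\<in>UNIV. ?\<delta> a i * F i) = F a" "(\<Sum>i\<in>UNIV. ?\<delta> i a * F i) = F a" for a :: 'n and F :: "'n \<Rightarrow> real"
    by (simp_all add: if_distrib if_distribR cong: if_cong)
  let ?N = "(norm (grad f x))\<^sup>2" and ?n = "real CARD('n)"
  have S1: "(\<Sum>i\<in>UNIV. partial_deriv i (christoffel g i j k) x) = ?H j k + ?H k j - ?\<delta> j k * laplacian f x"
    unfolding pchr sum_subtractf sum.distrib d1 sum_distrib_left[symmetric] lap ..
  have S2: "(\<Sum>i\<in>UNIV. partial_deriv j (christoffel g i i k) x) = ?n * ?H j k"
    unfolding pchr sum_subtractf sum.distrib d1 by simp
  have tr: "(\<Sum>i\<in>UNIV. christoffel g i i m x) = ?n * df m x" for m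
    unfolding chr sum_subtractf sum.distrib d1 by simp
  have "(\<Sum>i\<in>UNIV. \<Sum>m\<in>UNIV. christoffel g m j k x * christoffel g i i m x)
      = (\<Sum>m\<in>UNIV. christoffel g m j k x * (\<Sum>i\<in>UNIV. christoffel g i i m x))"
    by (subst sum.swap) (simp add: sum_distrib_left)
  also have "\<dots> = ?n * (\<Sum>m\<in>UNIV. christoffel g m j k x * df m x)"
    unfolding tr by (simp add: sum_distrib_left mult_ac)
  also have "(\<Sum>m\<in>UNIV. christoffel g m j k x * df m x) =
      (\<Sum>m\<in>UNIV. ?\<delta> m j * (df k x * df m x) + ?\<delta> m k * (df j x * df m x) - ?\<delta> j k * (df m x * df m x))"
    unfolding chr by (simp add: algebra_simps)
  also have "\<dots> = 2 * (df j x * df k x) - ?\<delta> j k * ?N"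
    unfolding sum_subtractf sum.distrib d1 sum_distrib_left[symmetric] nrm by simp
  finally have S3: "(\<Sum>i\<in>UNIV. \<Sum>m\<in>UNIV. christoffel g m j k x * christoffel g i i m x) =
      ?n * (2 * (df j x * df k x) - ?\<delta> j k * ?N)" .
  have inner: "(\<Sum>m\<in>UNIV. christoffel g m i k x * christoffel g i j m x) =
      df k x * df j x + ?\<delta> i j * (df i x * df k x) + ?\<delta> i k * (df i x * df j x)
       - ?\<delta> j k * (df i x * df i x) - ?\<delta> i k * (?\<delta> i j * ?N)" for i
  proof -
    let ?B = "\<lambda>m. ?\<delta> i j * df m x + ?\<delta> i m * df j x - ?\<delta> j m * df i x"
    have "(\<Sum>m\<in>UNIV. df m x * ?B m) =
       (\<Sum>m\<in>UNIV. ?\<delta> i j * (df m x * df m x) + ?\<delta> i m * (df m x * df j x) - ?\<delta> j m * (df m x * df i x))"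
      by (simp add: algebra_simps)
    also have "\<dots> = ?\<delta> i j * ?N"
      unfolding sum_subtractf sum.distrib d1 sum_distrib_left[symmetric] nrm by simp
    finally have B: "(\<Sum>m\<in>UNIV. df m x * ?B m) = ?\<delta> i j * ?N" .
    have "(\<Sum>m\<in>UNIV. christoffel g m i k x * christoffel g i j m x) =
      (\<Sum>m\<in>UNIV. ?\<delta> m i * (df k x * ?B m) + ?\<delta> m k * (df i x * ?B m) - ?\<delta> i k * (df m x * ?B m))"
      unfolding chr by (simp add: algebra_simps)
    also have "\<dots> = df k x * ?B i + df i x * ?B k - ?\<delta> i k * (?\<delta> i j * ?N)"
      unfolding sum_subtractf sum.distrib d1 sum_distrib_left[symmetric] B ..
    also have "\<dots> = df k x * df j x + ?\<delta> i j * (df i x * df k x) + ?\<delta> i k * (df i x * df j x)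
       - ?\<delta> j k * (df i x * df i x) - ?\<delta> i k * (?\<delta> i j * ?N)"
      by (simp add: algebra_simps)
    finally show ?thesis .
  qed
  have S4: "(\<Sum>i\<in>UNIV. \<Sum>m\<in>UNIV. christoffel g m i k x * christoffel g i j m x) =
      (?n + 2) * (df j x * df k x) - 2 * (?\<delta> j k * ?N)"
    unfolding inner sum_subtractf sum.distrib d1 sum_distrib_left[symmetric] nrm
    by (simp add: algebra_simps)
  have "ricci g x $ j $ k = (\<Sum>i\<in>UNIV. partial_deriv i (christoffel g i j k) x)
     - (\<Sum>i\<in>UNIV. partial_deriv j (christoffel g i i k) x)
     + ((\<Sum>i\<in>UNIV. \<Sum>m\<in>UNIV. christoffel g m j k x * christoffel g i i m x)
       - (\<Sum>i\<in>UNIV. \<Sum>m\<in>UNIV. christoffel g m i k x * christoffel g i j m x))"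
    by (simp add: ricci_def riemann_def sum.distrib sum_subtractf)
  also have "\<dots> = ?H j k + ?H k j - ?n * ?H j k + (?n - 2) * (df j x * df k x)
     - ?\<delta> j k * (laplacian f x + (?n - 2) * ?N)"
    unfolding S1 S2 S3 S4 by (simp add: algebra_simps)
  finally show ?thesis by simp
qed

lemma scalar_curvature_conformal:
  "exp (2 * f x) * scalar_curvature g x = - 2 * (real CARD('n) - 1) * laplacian f x
     - (real CARD('n) - 1) * (real CARD('n) - 2) * (norm (grad f x))\<^sup>2"
proof -
  let ?n = "real CARD('n)"
  have lap: "(\<Sum>i\<in>UNIV. dderiv (axis i 1) (df i) x) = laplacian f x" by (simp add: laplacian_def sum_Basis_axis)
  have nrm: "(\<Sum>i\<in>UNIV. df i x * df i x) = (norm (grad f x))\<^sup>2"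
    unfolding norm_grad_sq sum_Basis_axis by (simp add: power2_eq_square)
  have "scalar_curvature g x = (\<Sum>i\<in>UNIV. exp (- 2 * f x) * ricci g x $ i $ i)"
    unfolding scalar_curvature_def conformal_inv_entry
    by (simp add: if_distrib if_distribR cong: if_cong)
  then have "exp (2 * f x) * scalar_curvature g x = (\<Sum>i\<in>UNIV. ricci g x $ i $ i)"
    by (simp add: sum_distrib_left[symmetric] exp_minus)
  also have "\<dots> = (\<Sum>i\<in>UNIV. (2 - ?n) * dderiv (axis i 1) (df i) x + (?n - 2) * (df i x * df i x)
      - (laplacian f x + (?n - 2) * (norm (grad f x))\<^sup>2))"
    by (simp add: ricci_conformal algebra_simps)
  also have "\<dots> = (2 - ?n) * laplacian f x + (?n - 2) * (norm (grad f x))\<^sup>2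
      - ?n * (laplacian f x + (?n - 2) * (norm (grad f x))\<^sup>2)"
    unfolding sum_subtractf sum.distrib sum_distrib_left[symmetric] lap nrm by (simp add: algebra_simps)
  finally show ?thesis by (simp add: algebra_simps)
qed

lemma ricci_quadratic_form:
  "v \<bullet> (ricci g x *v v) = - (real CARD('n) - 2) * (dderiv v (dderiv v f) x - (dderiv v f x)\<^sup>2)
     - (laplacian f x + (real CARD('n) - 2) * (norm (grad f x))\<^sup>2) * (v \<bullet> v)"
proof -
  let ?n = "real CARD('n)"
  let ?L = "laplacian f x + (?n - 2) * (norm (grad f x))\<^sup>2"
  let ?H = "\<lambda>l m. dderiv (axis l 1) (df m) x"
  have lin1: "dderiv u f y = (\<Sum>i\<in>UNIV. u $ i * df i y)" for u y
  proof -
    have "dderiv u f y = (\<Sum>b\<in>Basis. dderiv b f y * (u \<bullet> b))"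
      unfolding C2_grad[OF C2, of u] by (simp add: grad_def inner_sum_left inner_commute[of u])
    then show ?thesis unfolding sum_Basis_axis by (simp add: inner_axis mult.commute)
  qed
  have lin2: "dderiv u (df k) x = (\<Sum>i\<in>UNIV. u $ i * ?H i k)" for u k
  proof -
    have "dderiv u (df k) x = (\<Sum>b\<in>Basis. dderiv b (df k) x * (u \<bullet> b))"
      unfolding has_derivative_grad[OF C2_has_derivative(2)[OF C2], of u]
      by (simp add: grad_def inner_sum_left inner_commute[of u])
    then show ?thesis unfolding sum_Basis_axis by (simp add: inner_axis mult.commute)
  qed
  have eq: "dderiv v f = (\<lambda>y. \<Sum>k\<in>UNIV. v $ k * df k y)" using lin1 by blast
  have "(dderiv v f has_derivative (\<lambda>w. \<Sum>k\<in>UNIV. v $ k * dderiv w (df k) x)) (at x)"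
    unfolding eq by (intro has_derivative_sum has_derivative_mult_right C2_has_derivative(2)[OF C2])
  then have "dderiv v (dderiv v f) x = (\<Sum>k\<in>UNIV. v $ k * dderiv v (df k) x)"
    by (rule dderiv_eqI)
  also have "\<dots> = (\<Sum>k\<in>UNIV. \<Sum>j\<in>UNIV. v $ j * v $ k * ?H j k)"
    unfolding lin2[of v] by (simp add: sum_distrib_left mult_ac)
  finally have HH: "(\<Sum>k\<in>UNIV. \<Sum>j\<in>UNIV. v $ j * v $ k * ?H j k) = dderiv v (dderiv v f) x" ..
  have HH': "(\<Sum>k\<in>UNIV. \<Sum>j\<in>UNIV. v $ j * v $ k * ?H k j) = dderiv v (dderiv v f) x"
    unfolding HH[symmetric] by (subst sum.swap) (simp add: mult_ac)
  have DD: "(\<Sum>k\<in>UNIV. \<Sum>j\<in>UNIV. v $ j * v $ k * (df j x * df k x)) = (dderiv v f x)\<^sup>2"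
    unfolding lin1[of v] power2_eq_square sum_product by (simp add: mult_ac)
  have II: "(\<Sum>k\<in>UNIV. \<Sum>j\<in>UNIV. v $ j * v $ k * (if j = k then ?L else 0)) = ?L * (v \<bullet> v)"
    by (simp add: inner_vec_def sum_distrib_right mult_ac if_distrib cong: if_cong)
  have "v \<bullet> (ricci g x *v v) = (\<Sum>k\<in>UNIV. \<Sum>j\<in>UNIV. v $ j * v $ k * ricci g x $ j $ k)"
    unfolding inner_vec_def matrix_vector_mult_def
    by (subst sum.swap) (simp add: sum_distrib_left mult_ac)
  also have "\<dots> = (\<Sum>k\<in>UNIV. \<Sum>j\<in>UNIV. v $ j * v $ k * ?H j k + v $ j * v $ k * ?H k j
      - ?n * (v $ j * v $ k * ?H j k) + (?n - 2) * (v $ j * v $ k * (df j x * df k x))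
      - v $ j * v $ k * (if j = k then ?L else 0))"
    unfolding ricci_conformal by (simp add: algebra_simps)
  also have "\<dots> = dderiv v (dderiv v f) x + dderiv v (dderiv v f) x - ?n * dderiv v (dderiv v f) x
      + (?n - 2) * (dderiv v f x)\<^sup>2 - ?L * (v \<bullet> v)"
    unfolding sum_subtractf sum.distrib sum_distrib_left[symmetric] HH HH' DD II ..
  finally show ?thesis by (simp add: algebra_simps)
qed

lemma modified_schouten_quadratic_form:
  assumes n: "CARD('n) \<ge> 2"
  shows "v \<bullet> (modified_schouten \<tau> g x *v v) =
    - (real CARD('n) - 2) * (dderiv v (dderiv v f) x - (dderiv v f x)\<^sup>2)
    - ((1 - \<tau>) * laplacian f x + (real CARD('n) - 2) * (1 - \<tau> / 2) * (norm (grad f x))\<^sup>2) * (v \<bullet> v)"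
proof -
  let ?n = "real CARD('n)"
  have n1: "?n - 1 > 0" using n by simp
  have "(g x) *v v = exp (2 * f x) *\<^sub>R v"
    by (simp add: g scaleR_matrix_vector_assoc[symmetric])
  then have "v \<bullet> (modified_schouten \<tau> g x *v v) =
     v \<bullet> (ricci g x *v v) - \<tau> / (2 * (?n - 1)) * (exp (2 * f x) * scalar_curvature g x) * (v \<bullet> v)"
    unfolding modified_schouten_def
    by (simp add: matrix_vector_mult_diff_rdistrib scaleR_matrix_vector_assoc[symmetric] inner_diff_right)
  also have "\<tau> / (2 * (?n - 1)) * (exp (2 * f x) * scalar_curvature g x) =
      \<tau> * (- laplacian f x - (?n - 2) / 2 * (norm (grad f x))\<^sup>2)"
    unfolding scalar_curvature_conformal using n1 by (simp add: field_simps)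
  finally show ?thesis unfolding ricci_quadratic_form by (simp add: algebra_simps diff_divide_distrib)
qed

end

text \<open>
  Summing the pinching inequality over an orthonormal basis gives
  \<open>(2 (N - 1) - N \<tau>) (- (N - 2)/2 |\<nabla>f|\<^sup>2 - \<Delta>f) \<ge> 0\<close>; the upper bound on \<open>\<tau>\<close> says that the first factor
  is positive, and the second is a positive multiple of the scalar curvature. Lowering \<open>\<tau>\<close> adds
  a nonnegative multiple of this second factor to the pinching inequality.
\<close>

lemma
  fixes f :: "'a::euclidean_space \<Rightarrow> real"
  defines "N \<equiv> real DIM('a)"
  assumes C2: "C2 f" and N: "N \<ge> 3" and \<tau>: "0 < \<tau>" "\<tau> < 2 * (N - 1) / N"
    and nonneg: "\<And>v. norm v = 1 \<Longrightarrow> 0 \<le> - (N - 2) * (dderiv v (dderiv v f) x - (dderiv v f x)\<^sup>2)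
      - ((1 - \<tau>) * laplacian f x + (N - 2) * (1 - \<tau> / 2) * (norm (grad f x))\<^sup>2)"
  shows laplacian_le_of_pinching: "laplacian f x \<le> - (N - 2) / 2 * (norm (grad f x))\<^sup>2"
    and pinching_weaken: "norm v = 1 \<Longrightarrow> \<theta> \<le> \<tau> \<Longrightarrow>
      0 \<le> - (N - 2) * (dderiv v (dderiv v f) x - (dderiv v f x)\<^sup>2)
      - ((1 - \<theta>) * laplacian f x + (N - 2) * (1 - \<theta> / 2) * (norm (grad f x))\<^sup>2)"
proof -
  define L G where "L = laplacian f x" and "G = (norm (grad f x))\<^sup>2"
  have "0 \<le> (\<Sum>b\<in>Basis. - (N - 2) * (dderiv b (dderiv b f) x - (dderiv b f x)\<^sup>2)
      - ((1 - \<tau>) * L + (N - 2) * (1 - \<tau> / 2) * G))"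
    unfolding L_def G_def by (intro sum_nonneg nonneg) auto
  also have "\<dots> = - (N - 2) * (L - G) - N * ((1 - \<tau>) * L + (N - 2) * (1 - \<tau> / 2) * G)"
    unfolding sum_subtractf sum_distrib_left[symmetric]
    by (simp add: L_def G_def laplacian_def norm_grad_sq N_def)
  also have "\<dots> = (2 * (N - 1) - N * \<tau>) * (- (N - 2) / 2 * G - L)"
    by (simp add: field_simps)
  finally have "0 \<le> (2 * (N - 1) - N * \<tau>) * (- (N - 2) / 2 * G - L)" .
  moreover have "2 * (N - 1) - N * \<tau> > 0" using \<tau> N by (simp add: field_simps)
  ultimately have "0 \<le> - (N - 2) / 2 * G - L" by (simp add: zero_le_mult_iff)
  then have LG: "L \<le> - (N - 2) / 2 * G" by simp
  then show "laplacian f x \<le> - (N - 2) / 2 * (norm (grad f x))\<^sup>2" by (simp add: L_def G_def)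
  assume v: "norm v = 1" and le: "\<theta> \<le> \<tau>"
  have "0 \<le> (\<tau> - \<theta>) * (- (N - 2) / 2 * G - L)" using LG le by simp
  then show "0 \<le> - (N - 2) * (dderiv v (dderiv v f) x - (dderiv v f x)\<^sup>2)
      - ((1 - \<theta>) * laplacian f x + (N - 2) * (1 - \<theta> / 2) * (norm (grad f x))\<^sup>2)"
    using nonneg[OF v] by (fold L_def G_def) (simp add: field_simps)
qed

section \<open>Growth of subsolutions by comparison with powers of the distance\<close>

lemma second_derivative_at_local_max:
  fixes h :: "real \<Rightarrow> real"
  assumes "\<delta> > 0"
    and der: "\<And>s. \<bar>s\<bar> < \<delta> \<Longrightarrow> (h has_real_derivative h' s) (at s)"
    and der2: "(h' has_real_derivative d) (at 0)"
    and max: "\<And>s. \<bar>s\<bar> < \<delta> \<Longrightarrow> h s \<le> h 0"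
  shows "d \<le> 0"
proof (rule ccontr)
  assume "\<not> d \<le> 0"
  then have "d > 0" by simp
  have h0: "h' 0 = 0"
    by (rule DERIV_local_max[OF der \<open>\<delta> > 0\<close>]) (use max \<open>\<delta> > 0\<close> in auto)
  obtain \<epsilon> where "\<epsilon> > 0" and inc: "\<And>s. s > 0 \<Longrightarrow> s < \<epsilon> \<Longrightarrow> h' 0 < h' (0 + s)"
    using DERIV_pos_inc_right[OF der2 \<open>d > 0\<close>] by blast
  define s where "s = min \<epsilon> \<delta> / 2"
  have s: "0 < s" "s < \<epsilon>" "s < \<delta>" using \<open>\<epsilon> > 0\<close> \<open>\<delta> > 0\<close> by (auto simp: s_def min_def)
  have "h 0 < h s"
  proof (rule DERIV_pos_imp_increasing_open[OF s(1)])
    show "\<exists>y. (h has_real_derivative y) (at x) \<and> 0 < y" if "0 < x" "x < s" for x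
      using der[of x] inc[of x] h0 that s by force
    show "continuous_on {0..s} h"
    proof (rule DERIV_continuous_on)
      show "(h has_real_derivative h' x) (at x within {0..s})" if "x \<in> {0..s}" for x
        using der[of x] that s by (auto intro: has_field_derivative_at_within)
    qed
  qed
  then show False using max[of s] s by simp
qed

lemma
  fixes w e :: "'a::euclidean_space"
  assumes w: "w + s *\<^sub>R e \<noteq> 0"
  shows DERIV_norm_powr_line: "((\<lambda>s. norm (w + s *\<^sub>R e) powr \<beta>) has_real_derivative
      \<beta> * norm (w + s *\<^sub>R e) powr (\<beta> - 2) * ((w + s *\<^sub>R e) \<bullet> e)) (at s)" (is ?thesis1)
    and DERIV2_norm_powr_line: "((\<lambda>s. \<beta> * norm (w + s *\<^sub>R e) powr (\<beta> - 2) * ((w + s *\<^sub>R e) \<bullet> e)) has_real_derivative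
      \<beta> * norm (w + s *\<^sub>R e) powr (\<beta> - 2) * ((norm e)\<^sup>2 + (\<beta> - 2) * (((w + s *\<^sub>R e) \<bullet> e) / norm (w + s *\<^sub>R e))\<^sup>2)) (at s)" (is ?thesis2)
proof -
  let ?N = "\<lambda>s. norm (w + s *\<^sub>R e)"
  have N: "?N s > 0" using w by simp
  have dN: "(?N has_real_derivative ((w + s *\<^sub>R e) \<bullet> e) / ?N s) (at s)"
  proof -
    have "((\<lambda>s. w + s *\<^sub>R e) has_derivative (\<lambda>h. h *\<^sub>R e)) (at s)"
      by (auto intro!: derivative_eq_intros)
    from has_derivative_compose[OF this has_derivative_norm[OF w]]
    show ?thesis
      by (auto simp: has_field_derivative_def sgn_div_norm inner_commute divide_inverse mult_ac elim!: has_derivative_eq_rhs)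
  qed
  show d1: ?thesis1
    using has_real_derivative_powr'[OF dN DERIV_const[of \<beta>]] N
    by (auto simp: divide_simps powr_diff power2_eq_square elim!: DERIV_cong)
  have d1': "((\<lambda>s. ?N s powr (\<beta> - 2)) has_real_derivative
      (\<beta> - 2) * (?N s powr (\<beta> - 2) / (?N s)\<^sup>2) * ((w + s *\<^sub>R e) \<bullet> e)) (at s)"
    using has_real_derivative_powr'[OF dN DERIV_const[of "\<beta> - 2"]] N
    by (auto simp: divide_simps powr_diff power2_eq_square elim!: DERIV_cong)
  have d2: "((\<lambda>s. (w + s *\<^sub>R e) \<bullet> e) has_real_derivative (norm e)\<^sup>2) (at s)"
    by (auto intro!: derivative_eq_intros simp: has_field_derivative_def power2_norm_eq_inner inner_add_left mult.commute)
  show ?thesis2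
    by (rule DERIV_cong[OF DERIV_mult[OF DERIV_cmult[OF d1', of \<beta>] d2]])
      (use N in \<open>simp add: power_divide algebra_simps power2_eq_square\<close>)
qed


text \<open>
  Comparison with \<open>\<psi>(z) = A |z - x0| powr \<beta>\<close>. Away from \<open>x0\<close> its Hessian has the eigenvalue
  \<open>A \<beta> (\<beta> - 1) r powr (\<beta> - 2)\<close> in the radial direction and \<open>A \<beta> r powr (\<beta> - 2)\<close> in all others, so the
  condition on the exponent says that \<open>\<psi>\<close> is a strict supersolution when tested with the radial
  direction. Since \<open>\<beta> > 0\<close>, the function \<open>\<psi>\<close> vanishes at \<open>x0\<close>, which makes the single point \<open>x0\<close> an
  effective piece of boundary. The constant \<open>A\<close> makes \<open>v - v x0\<close> and \<open>\<psi>\<close> agree at \<open>x\<close>, so \<open>v - v x0\<close> has to reach \<open>\<psi>\<close>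
  somewhere on the sphere of radius \<open>\<rho>\<close>.
\<close>

lemma growth_of_subsolution:
  fixes v :: "'a::euclidean_space \<Rightarrow> real" and p q \<beta> :: real
  assumes C2: "C2 v" and p: "p \<ge> 0" and q: "q \<ge> 0" and \<beta>: "\<beta> > 0"
    and sub: "\<And>z e. norm e = 1 \<Longrightarrow> 0 \<le> p * dderiv e (dderiv e v) z + q * laplacian v z"
    and exponent: "p * (\<beta> - 1) + q * (real DIM('a) + \<beta> - 2) < 0"
    and gt: "v x > v x0" and \<rho>: "norm (x - x0) < \<rho>"
  shows "\<exists>z. norm (z - x0) = \<rho> \<and> (v x - v x0) / norm (x - x0) powr \<beta> * \<rho> powr \<beta> \<le> v z - v x0"
proof (rule ccontr)
  assume contra: "\<not> ?thesis"
  define A where "A = (v x - v x0) / norm (x - x0) powr \<beta>"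
  have xx0: "x \<noteq> x0" using gt by auto
  then have A: "A > 0" using gt by (simp add: A_def)
  have lt: "v z - v x0 < A * \<rho> powr \<beta>" if "norm (z - x0) = \<rho>" for z
    using contra that by (auto simp: A_def not_le)
  define \<Phi> where "\<Phi> z = v z - v x0 - A * norm (z - x0) powr \<beta>" for z
  have contv: "continuous_on UNIV v" using C2_continuous[OF C2] by blast
  have "continuous_on (cball x0 \<rho>) \<Phi>" unfolding \<Phi>_def
    using \<beta> by (intro continuous_intros continuous_on_powr' continuous_on_subset[OF contv]) auto
  moreover have "cball x0 \<rho> \<noteq> {}" using \<rho> norm_ge_zero[of "x - x0"] by (simp add: not_less del: norm_ge_zero)
  ultimately obtain z0 where z0: "z0 \<in> cball x0 \<rho>" "\<And>z. z \<in> cball x0 \<rho> \<Longrightarrow> \<Phi> z \<le> \<Phi> z0"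
    using continuous_attains_sup[OF compact_cball] by blast
  have \<Phi>x: "\<Phi> x = 0" using xx0 by (simp add: \<Phi>_def A_def)
  have \<Phi>x0: "\<Phi> x0 = 0" using \<beta> by (simp add: \<Phi>_def)
  have xin: "x \<in> cball x0 \<rho>" using \<rho> by (simp add: dist_norm norm_minus_commute)
  \<comment> \<open>The maximum could sit at \<open>x0\<close>, where \<open>\<psi>\<close> is not differentiable; but then it is \<open>0\<close> and is also
  attained at \<open>x\<close>.\<close>
  obtain z where z: "z \<in> cball x0 \<rho>" "z \<noteq> x0" "\<Phi> z \<ge> 0" and zmax: "\<And>y. y \<in> cball x0 \<rho> \<Longrightarrow> \<Phi> y \<le> \<Phi> z"
  proof (cases "z0 = x0")
    case True
    then show ?thesis using that[of x] z0 \<Phi>x \<Phi>x0 xin xx0 by auto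
  next
    case False
    then show ?thesis using that[of z0] z0 z0(2)[OF xin] \<Phi>x by auto
  qed
  have "norm (z - x0) \<noteq> \<rho>" using lt[of z] z(3) by (auto simp: \<Phi>_def)
  then have zr: "norm (z - x0) < \<rho>" using z(1) by (simp add: dist_norm norm_minus_commute)
  define w where "w = z - x0"
  have w0: "w \<noteq> 0" using z(2) by (simp add: w_def)
  define r where "r = norm w"
  have r: "r > 0" using w0 by (simp add: r_def)
  \<comment> \<open>At the interior maximum \<open>z\<close> the Hessian of \<open>v\<close> lies below that of \<open>\<psi>\<close>.\<close>
  have hess: "dderiv e (dderiv e v) z \<le> A * (\<beta> * r powr (\<beta> - 2) * (1 + (\<beta> - 2) * (w \<bullet> e / r)\<^sup>2))"
    if e: "norm e = 1" for e
  proof -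
    define \<delta> where "\<delta> = min (\<rho> - r) r"
    have \<delta>: "\<delta> > 0" using zr r by (simp add: \<delta>_def r_def w_def)
    have near: "w + s *\<^sub>R e \<noteq> 0" "z + s *\<^sub>R e \<in> cball x0 \<rho>" if "\<bar>s\<bar> < \<delta>" for s
    proof -
      have n: "norm (s *\<^sub>R e) < \<delta>" using that e by simp
      then show "w + s *\<^sub>R e \<noteq> 0"
        using norm_triangle_sub[of w "- (s *\<^sub>R e)"] by (auto simp: \<delta>_def r_def)
      have "norm (w + s *\<^sub>R e) \<le> r + \<bar>s\<bar>" using norm_triangle_ineq[of w "s *\<^sub>R e"] e by (simp add: r_def)
      then show "z + s *\<^sub>R e \<in> cball x0 \<rho>"
        using that by (simp add: \<delta>_def w_def dist_norm norm_minus_commute[of x0] algebra_simps)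
    qed
    define h where "h s = v (z + s *\<^sub>R e) - A * norm (w + s *\<^sub>R e) powr \<beta>" for s
    define h' where "h' s = dderiv e v (z + s *\<^sub>R e) - A * (\<beta> * norm (w + s *\<^sub>R e) powr (\<beta> - 2) * ((w + s *\<^sub>R e) \<bullet> e))" for s
    have "dderiv e (dderiv e v) z - A * (\<beta> * r powr (\<beta> - 2) * (1 + (\<beta> - 2) * (w \<bullet> e / r)\<^sup>2)) \<le> 0"
    proof (rule second_derivative_at_local_max[OF \<delta>])
      show "(h has_real_derivative h' s) (at s)" if "\<bar>s\<bar> < \<delta>" for s
        unfolding h_def h'_def
        by (intro DERIV_diff DERIV_cmult DERIV_norm_powr_line near(1)[OF that]
            has_field_derivative_along_line C2_has_derivative(1)[OF C2])
      have "((\<lambda>s. dderiv e v (z + s *\<^sub>R e)) has_real_derivative dderiv e (dderiv e v) (z + 0 *\<^sub>R e)) (at 0)"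
        by (intro has_field_derivative_along_line C2_has_derivative(2)[OF C2])
      from DERIV_diff[OF this DERIV_cmult[OF DERIV2_norm_powr_line[of w 0 e \<beta>], of A]]
      show "(h' has_real_derivative dderiv e (dderiv e v) z - A * (\<beta> * r powr (\<beta> - 2) * (1 + (\<beta> - 2) * (w \<bullet> e / r)\<^sup>2))) (at 0)"
        using w0 e unfolding h'_def by (simp add: r_def)
      show "h s \<le> h 0" if "\<bar>s\<bar> < \<delta>" for s
        using zmax[OF near(2)[OF that]] by (simp add: \<Phi>_def h_def w_def algebra_simps)
    qed
    then show ?thesis by simp
  qed
  define K where "K = A * (\<beta> * r powr (\<beta> - 2))"
  have K: "K > 0" using A \<beta> r by (simp add: K_def)
  have "w \<bullet> (w /\<^sub>R r) / r = 1" using r by (simp add: r_def dot_square_norm power2_eq_square)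
  then have 1: "dderiv (w /\<^sub>R r) (dderiv (w /\<^sub>R r) v) z \<le> K * (\<beta> - 1)"
    using hess[of "w /\<^sub>R r"] r by (simp add: r_def K_def mult.assoc)
  have "laplacian v z \<le> (\<Sum>b\<in>Basis. K * (1 + (\<beta> - 2) * (w \<bullet> b / r)\<^sup>2))"
    unfolding laplacian_def using hess by (intro sum_mono) (simp add: K_def mult.assoc)
  also have "\<dots> = K * (real DIM('a) + (\<beta> - 2) * (\<Sum>b\<in>Basis. (w \<bullet> b / r)\<^sup>2))"
    unfolding sum_distrib_left[symmetric] sum.distrib by simp
  also have "(\<Sum>b\<in>Basis. (w \<bullet> b / r)\<^sup>2) = (\<Sum>b\<in>Basis. (w \<bullet> b)\<^sup>2) / r\<^sup>2"
    by (simp add: power_divide sum_divide_distrib)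
  also have "(\<Sum>b\<in>Basis. (w \<bullet> b)\<^sup>2) = r\<^sup>2"
    unfolding r_def power2_norm_eq_inner by (subst (2) euclidean_inner) (simp add: power2_eq_square)
  finally have 2: "laplacian v z \<le> K * (real DIM('a) + \<beta> - 2)" using r by (simp add: add_diff_eq)
  have "0 \<le> p * dderiv (w /\<^sub>R r) (dderiv (w /\<^sub>R r) v) z + q * laplacian v z"
    by (rule sub) (use r in \<open>simp add: r_def\<close>)
  also have "\<dots> \<le> p * (K * (\<beta> - 1)) + q * (K * (real DIM('a) + \<beta> - 2))"
    using 1 2 p q by (intro add_mono mult_left_mono)
  also have "\<dots> = K * (p * (\<beta> - 1) + q * (real DIM('a) + \<beta> - 2))" by (simp add: algebra_simps)
  also have "\<dots> < 0" using K exponent by (simp add: mult_pos_neg)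
  finally show False by simp
qed

text \<open>
  Passing from \<open>f\<close> to \<open>exp (- \<alpha> f)\<close> adds, up to a positive factor,
  \<open>\<alpha> ((N - 2) f\<^sub>e\<^sup>2 + (1 - \<theta>) |\<nabla>f|\<^sup>2)\<close> to the pinching inequality.
  As \<open>f\<^sub>e\<^sup>2 \<le> |\<nabla>f|\<^sup>2\<close>, the worst case is \<open>e\<close> parallel to the gradient, and the stated value of \<open>\<alpha>\<close> is the one
  for which all first-order terms cancel there.
\<close>

lemma exp_power_subsolution:
  fixes f :: "'a::euclidean_space \<Rightarrow> real"
  defines "N \<equiv> real DIM('a)"
  assumes C2: "C2 f" and N: "N \<ge> 2" and e: "norm e = 1"
    and \<alpha>: "0 < \<alpha>" "\<alpha> \<le> 1" "\<alpha> * (N - 1 - \<theta>) = (N - 2) * \<theta> / 2"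
    and pinch: "0 \<le> - (N - 2) * (dderiv e (dderiv e f) x - (dderiv e f x)\<^sup>2)
      - ((1 - \<theta>) * laplacian f x + (N - 2) * (1 - \<theta> / 2) * (norm (grad f x))\<^sup>2)"
  shows "0 \<le> (N - 2) * dderiv e (dderiv e (\<lambda>x. exp (- \<alpha> * f x))) x
            + (1 - \<theta>) * laplacian (\<lambda>x. exp (- \<alpha> * f x)) x"
proof -
  define H L d G where "H = dderiv e (dderiv e f) x" and "L = laplacian f x"
    and "d = dderiv e f x" and "G = (norm (grad f x))\<^sup>2"
  have dG: "d\<^sup>2 \<le> G"
  proof -
    have "\<bar>d\<bar> \<le> norm (grad f x)"
      using Cauchy_Schwarz_ineq2[of "grad f x" e] e by (simp add: d_def C2_grad[OF C2])
    then show ?thesis unfolding G_def by (metis abs_ge_zero power2_abs power_mono)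
  qed
  have "(N - 2) * dderiv e (dderiv e (\<lambda>x. exp (- \<alpha> * f x))) x
            + (1 - \<theta>) * laplacian (\<lambda>x. exp (- \<alpha> * f x)) x
     = exp (- \<alpha> * f x) * \<alpha> * (- (N - 2) * H - (1 - \<theta>) * L + \<alpha> * ((N - 2) * d\<^sup>2 + (1 - \<theta>) * G))"
    unfolding dderiv2_exp[OF C2] laplacian_exp[OF C2]
    by (simp add: H_def L_def d_def G_def power2_eq_square algebra_simps)
  moreover have "- (N - 2) * H - (1 - \<theta>) * L + \<alpha> * ((N - 2) * d\<^sup>2 + (1 - \<theta>) * G) \<ge> 0"
  proof -
    have "0 \<le> (N - 2) * (1 - \<alpha>) * (G - d\<^sup>2) + (\<alpha> * (N - 1 - \<theta>) - (N - 2) * \<theta> / 2) * G"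
      unfolding \<alpha>(3) using N \<alpha>(2) dG by simp
    also have "\<dots> \<le> - (N - 2) * H - (1 - \<theta>) * L + \<alpha> * ((N - 2) * d\<^sup>2 + (1 - \<theta>) * G)"
      using pinch by (fold H_def L_def d_def G_def) (simp add: algebra_simps)
    finally show ?thesis .
  qed
  ultimately show ?thesis using \<alpha> by simp
qed

text \<open>
  The exponent \<open>\<beta> = 3\<alpha>/2\<close> lies below the critical exponent \<open>2\<alpha>\<close>, as the comparison requires, while a
  lower bound of order \<open>t powr (3\<alpha>/2)\<close> for \<open>exp (- \<alpha> f)\<close> makes \<open>exp f\<close> of order \<open>t powr (-3/2)\<close>, with an
  exponent below \<open>-1\<close> as needed for finite length.
\<close>

lemma conformal_factor_decay:
  fixes f :: "'a::euclidean_space \<Rightarrow> real"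
  defines "N \<equiv> real DIM('a)"
  assumes C2: "C2 f" and N: "N \<ge> 3" and \<theta>: "0 < \<theta>" "\<theta> < 1"
    and pinch: "\<And>x e. norm e = 1 \<Longrightarrow> 0 \<le> - (N - 2) * (dderiv e (dderiv e f) x - (dderiv e f x)\<^sup>2)
      - ((1 - \<theta>) * laplacian f x + (N - 2) * (1 - \<theta> / 2) * (norm (grad f x))\<^sup>2)"
    and nonconst: "f x1 < f x0"
  shows "\<exists>T K. T \<ge> 1 \<and> K \<ge> 0 \<and> (\<forall>t\<ge>T. \<exists>z. norm (z - x0) = t \<and> exp (f z / 4) \<le> K * t powr (-3/8))"
proof -
  define \<alpha> where "\<alpha> = (N - 2) * \<theta> / (2 * (N - 1 - \<theta>))"
  have den: "N - 1 - \<theta> > 0" using N \<theta> by simp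
  have \<alpha>: "0 < \<alpha>" "\<alpha> \<le> 1" "\<alpha> * (N - 1 - \<theta>) = (N - 2) * \<theta> / 2"
  proof -
    show "0 < \<alpha>" using N \<theta> den by (simp add: \<alpha>_def)
    have "(N - 2) * \<theta> \<le> (N - 2) * 1" using N \<theta> by (intro mult_left_mono) auto
    then have "(N - 2) * \<theta> \<le> 2 * (N - 1 - \<theta>)" using N \<theta> by (simp add: algebra_simps)
    then show "\<alpha> \<le> 1" unfolding \<alpha>_def using den by (subst divide_le_eq_1_pos) auto
    have "M / (2 * D) * D = M / 2" if "D > 0" for M D :: real using that by simp
    from this[OF den] show "\<alpha> * (N - 1 - \<theta>) = (N - 2) * \<theta> / 2" by (simp only: \<alpha>_def)
  qed
  have N2: "N \<ge> 2" using N by simp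
  define v where "v x = exp (- \<alpha> * f x)" for x
  define r where "r = norm (x1 - x0)"
  have gt: "v x1 > v x0" using nonconst \<alpha> by (simp add: v_def)
  have r: "r > 0" using nonconst by (auto simp: r_def)
  define A where "A = (v x1 - v x0) / r powr (3/2 * \<alpha>)"
  have A: "A > 0" using gt r by (simp add: A_def)
  have growth: "\<exists>z. norm (z - x0) = t \<and> A * t powr (3/2 * \<alpha>) \<le> v z - v x0" if "t > r" for t
    unfolding A_def r_def
  proof (rule growth_of_subsolution[of v "N - 2" "1 - \<theta>"])
    show "C2 v" unfolding v_def by (rule C2_exp[OF C2])
    show "0 \<le> (N - 2) * dderiv e (dderiv e v) z + (1 - \<theta>) * laplacian v z" if "norm e = 1" for z e
      using exp_power_subsolution[OF C2 _ that \<alpha>(1,2), where \<theta>=\<theta> and x=z] N2 \<alpha>(3) pinch[OF that, of z]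
      unfolding v_def N_def by blast
    have "(N - 2) * (3/2 * \<alpha> - 1) + (1 - \<theta>) * (N + 3/2 * \<alpha> - 2) = 3/2 * (\<alpha> * (N - 1 - \<theta>)) - \<theta> * (N - 2)"
      by (simp add: field_simps)
    also have "\<dots> < 0" 
    proof -
      have "0 < (N - 2) * \<theta>" using N \<theta> by simp
      then show ?thesis unfolding \<alpha>(3) mult.commute[of \<theta>] by linarith
    qed
    finally show "(N - 2) * (3/2 * \<alpha> - 1) + (1 - \<theta>) * (real DIM('a) + 3/2 * \<alpha> - 2) < 0" by (simp add: N_def)
  qed (use N \<theta> \<alpha> gt that in \<open>auto simp: r_def\<close>)
  define K where "K = A powr (- 1 / (4 * \<alpha>))"
  have "\<exists>z. norm (z - x0) = t \<and> exp (f z / 4) \<le> K * t powr (-3/8)" if "t \<ge> r + 1" for t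
  proof -
    have t: "t > r" "t > 0" using that r by auto
    obtain z where z: "norm (z - x0) = t" "A * t powr (3/2 * \<alpha>) \<le> v z - v x0"
      using growth[OF t(1)] by blast
    have "A * t powr (3/2 * \<alpha>) \<le> v z" using z(2) exp_gt_zero[of "- \<alpha> * f x0"] unfolding v_def by linarith
    then have "v z powr (- 1 / (4 * \<alpha>)) \<le> (A * t powr (3/2 * \<alpha>)) powr (- 1 / (4 * \<alpha>))"
      using A t \<alpha> by (intro powr_mono2') auto
    also have "\<dots> = K * t powr (-3/8)"
      using A t \<alpha> by (simp add: K_def powr_mult powr_powr)
    also have "v z powr (- 1 / (4 * \<alpha>)) = exp (f z / 4)"
      using \<alpha> by (simp add: v_def powr_def)
    finally show ?thesis using z(1) by blast
  qed
  then show ?thesis using r by (intro exI[of _ "r + 1"] exI[of _ K]) (auto simp: K_def)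
qed

section \<open>Integral estimates for superharmonic functions\<close>

lemma compact_support_integrable:
  fixes h :: "'a::euclidean_space \<Rightarrow> real"
  assumes cont: "continuous_on UNIV h" and supp: "\<And>x. x \<notin> cbox a b \<Longrightarrow> h x = 0"
  shows "integrable lborel h" and "integral (cbox a b) h = integral\<^sup>L lborel h"
proof -
  have "(\<lambda>x. indicator (cbox a b) x *\<^sub>R h x) = h"
    using supp by (auto simp: fun_eq_iff indicator_def)
  moreover have "integrable lborel (\<lambda>x. indicator (cbox a b) x *\<^sub>R h x)"
    by (intro borel_integrable_compact compact_cbox continuous_on_subset[OF cont]) auto
  ultimately show int: "integrable lborel h" by simp
  have "(\<lambda>x. if x \<in> cbox a b then h x else 0) = h"
    using supp by (auto simp: fun_eq_iff)
  then have "(h has_integral integral\<^sup>L lborel h) (cbox a b)"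
    using has_integral_integral_lborel[OF int] has_integral_restrict_UNIV[of "cbox a b" h] by simp
  then show "integral (cbox a b) h = integral\<^sup>L lborel h" by (rule integral_unique)
qed

lemma compact_support_ball_integrable:
  fixes h :: "'a::euclidean_space \<Rightarrow> real"
  assumes cont: "continuous_on UNIV h" and supp: "\<And>x. norm x > R \<Longrightarrow> h x = 0"
  shows "integrable lborel h"
proof -
  obtain a where "cball 0 R \<subseteq> cbox (-a) (a::'a)"
    using bounded_subset_cbox_symmetric[OF bounded_cball] by blast
  then have "x \<notin> cbox (-a) a \<Longrightarrow> h x = 0" for x using supp[of x] by force
  then show ?thesis using compact_support_integrable(1)[OF cont] by blast
qed

lemma integral_lborel_affine:
  fixes h :: "'a::euclidean_space \<Rightarrow> real"
  assumes "continuous_on UNIV h" and "c > 0"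
  shows "integral\<^sup>L lborel h = c ^ DIM('a) * (\<integral>x. h (z + c *\<^sub>R x) \<partial>lborel)"
proof -
  have [measurable]: "h \<in> borel_measurable borel"
    using assms(1) by (rule borel_measurable_continuous_onI)
  show ?thesis
    using assms(2) by (subst lborel_affine[of c z]) (simp_all add: integral_density integral_distr)
qed

text \<open>
  The integral of \<open>f\<close> over the whole space is invariant under translations, so the derivative
  of \<open>s \<mapsto> \<integral> f (x + s e) dx\<close> at \<open>0\<close>, computed under the integral sign, vanishes. Summed over
  an orthonormal basis, this is the divergence theorem for compactly supported vector fields.
\<close>

lemma integral_dderiv_compact_support:
  fixes f :: "'a::euclidean_space \<Rightarrow> real"
  assumes der: "\<And>x. (f has_derivative (\<lambda>v. dderiv v f x)) (at x)"
    and cont: "continuous_on UNIV (dderiv e f)"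
    and supp: "\<And>x. norm x > R \<Longrightarrow> f x = 0"
  shows "integral\<^sup>L lborel (dderiv e f) = 0"
proof -
  have contf: "continuous_on UNIV f"
    by (rule has_derivative_continuous_on) (rule der)
  obtain a where a: "cball 0 (R + norm e) \<subseteq> cbox (-a) (a::'a)"
    using bounded_subset_cbox_symmetric[OF bounded_cball] by blast
  have out: "norm (x + s *\<^sub>R e) > R" if "x \<notin> cbox (-a) a" "s \<in> {-1<..<1}" for x s
  proof -
    have "norm x > R + norm e" using a that(1) by force
    moreover have "norm (s *\<^sub>R e) \<le> norm e" using that(2) by (auto simp: mult_left_le_one_le)
    moreover have "norm x \<le> norm (x + s *\<^sub>R e) + norm (s *\<^sub>R e)"
      by (metis add_diff_cancel norm_triangle_ineq4)
    ultimately show ?thesis by linarith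
  qed
  have supp': "dderiv e f x = 0" if "norm x > R" for x
  proof -
    have "open {x::'a. norm x > R}" by (intro open_Collect_less continuous_intros)
    then have "((\<lambda>_. 0) has_derivative (\<lambda>v. dderiv v f x)) (at x)"
      using has_derivative_transform_within_open[OF der[of x], of "{x. norm x > R}" "\<lambda>_. 0"] supp that by auto
    from has_derivative_unique[OF this has_derivative_const] show ?thesis by (simp add: fun_eq_iff)
  qed
  have cshift: "continuous_on UNIV (\<lambda>x. f (x + s *\<^sub>R e))" for s
    by (intro continuous_on_compose2[OF contf] continuous_intros) auto
  have const: "integral (cbox (-a) a) (\<lambda>x. f (x + s *\<^sub>R e)) = integral\<^sup>L lborel f" if "s \<in> {-1<..<1}" for s
  proof -
    have "integral (cbox (-a) a) (\<lambda>x. f (x + s *\<^sub>R e)) = (\<integral>x. f (x + s *\<^sub>R e) \<partial>lborel)"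
      by (rule compact_support_integrable(2)[OF cshift]) (use out that supp in blast)
    also have "\<dots> = integral\<^sup>L lborel f"
      using integral_lborel_affine[OF contf, of 1 "s *\<^sub>R e"] by (simp add: add.commute)
    finally show ?thesis .
  qed
  have "((\<lambda>s. integral (cbox (-a) a) (\<lambda>x. f (x + s *\<^sub>R e))) has_field_derivative
      integral (cbox (-a) a) (\<lambda>x. dderiv e f (x + 0 *\<^sub>R e))) (at 0 within {-1<..<1})"
  proof (rule leibniz_rule_field_derivative)
    show "((\<lambda>s. f (x + s *\<^sub>R e)) has_real_derivative dderiv e f (x + s *\<^sub>R e)) (at s within {-1<..<1})" for x s
      by (rule has_field_derivative_at_within, rule has_field_derivative_along_line, rule der)
    show "(\<lambda>x. f (x + s *\<^sub>R e)) integrable_on cbox (-a) a" for s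
      by (intro integrable_continuous continuous_on_subset[OF cshift]) auto
    show "continuous_on ({-1<..<1} \<times> cbox (-a) a) (\<lambda>(s, x). dderiv e f (x + s *\<^sub>R e))"
      unfolding split_beta by (intro continuous_on_compose2[OF cont] continuous_intros) auto
  qed auto
  then have 1: "((\<lambda>s. integral (cbox (-a) a) (\<lambda>x. f (x + s *\<^sub>R e))) has_real_derivative
      integral (cbox (-a) a) (dderiv e f)) (at 0)"
    by (subst (asm) at_within_open) auto
  have "((\<lambda>s. integral\<^sup>L lborel f) has_real_derivative integral (cbox (-a) a) (dderiv e f)) (at 0)"
    by (rule has_field_derivative_transform_within_open[OF 1, of "{-1<..<1}"]) (use const in auto)
  then have "integral (cbox (-a) a) (dderiv e f) = 0"
    using DERIV_unique DERIV_const by blast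
  moreover have "integral (cbox (-a) a) (dderiv e f) = integral\<^sup>L lborel (dderiv e f)"
    by (rule compact_support_integrable(2)[OF cont]) (use supp' out[of _ 0] in auto)
  ultimately show ?thesis by simp
qed

text \<open>
  The square of this function is a \<open>C\<^sup>1\<close> cut-off with gradient \<open>- 4 bump r x\<close> times \<open>x\<close>. Being radial, this gradient
  turns integration by parts into a statement about radial derivatives, with \<open>bump r\<close> itself as the
  averaging weight.
\<close>

definition bump :: "real \<Rightarrow> 'a::euclidean_space \<Rightarrow> real" where
  "bump r x = max 0 (r - x \<bullet> x)"

lemma bump_nonneg: "bump r x \<ge> 0" by (simp add: bump_def)

lemma bump_ge: "r - (norm x)\<^sup>2 \<le> bump r x" by (simp add: bump_def power2_norm_eq_inner)

lemma bump_eq_0: "(norm x)\<^sup>2 \<ge> r \<Longrightarrow> bump r x = 0" by (simp add: bump_def power2_norm_eq_inner)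

lemma continuous_on_bump [continuous_intros]:
  "continuous_on S g \<Longrightarrow> continuous_on S (\<lambda>x. bump r (g x))"
  unfolding bump_def by (intro continuous_intros)

lemma DERIV_max_0_sq: "((\<lambda>s::real. (max 0 s)\<^sup>2) has_real_derivative 2 * max 0 s) (at s)"
proof -
  consider "s > 0" | "s < 0" | "s = 0" by linarith
  then show ?thesis
  proof cases
    case 1
    have "((\<lambda>s::real. s\<^sup>2) has_real_derivative 2 * s) (at s)"
      by (auto intro!: derivative_eq_intros)
    then have "((\<lambda>s::real. (max 0 s)\<^sup>2) has_real_derivative 2 * s) (at s)"
      by (rule has_field_derivative_transform_within_open[of _ _ _ "{0<..}"]) (use 1 in auto)
    then show ?thesis using 1 by (simp add: max_def)
  next
    case 2
    have "((\<lambda>s::real. 0) has_real_derivative 0) (at s)" by simp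
    then have "((\<lambda>s::real. (max 0 s)\<^sup>2) has_real_derivative 0) (at s)"
      by (rule has_field_derivative_transform_within_open[of _ _ _ "{..<0}"]) (use 2 in auto)
    then show ?thesis using 2 by (simp add: max_def)
  next
    case 3
    have lim: "((\<lambda>h::real. max 0 h) \<longlongrightarrow> 0) (at 0)"
      using tendsto_max[OF tendsto_const tendsto_ident_at, of 0 "0::real" UNIV] by simp
    have "((\<lambda>h::real. (max 0 h)\<^sup>2 / h) \<longlongrightarrow> 0) (at 0)"
      by (rule Lim_transform_eventually[OF lim])
        (auto simp: eventually_at_filter max_def power2_eq_square)
    then show ?thesis using 3 by (simp add: DERIV_def)
  qed
qed

lemma has_derivative_bump_sq:
  "((\<lambda>x::'a::euclidean_space. (bump r x)\<^sup>2) has_derivative (\<lambda>v. - 4 * bump r x * (x \<bullet> v))) (at x)"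
proof -
  have "((\<lambda>x. r - x \<bullet> x) has_derivative (\<lambda>v. - 2 * (x \<bullet> v))) (at x)"
    by (auto intro!: derivative_eq_intros simp: inner_commute)
  from has_derivative_compose[OF this has_field_derivative_imp_has_derivative[OF DERIV_max_0_sq]]
  show ?thesis by (simp add: bump_def mult.commute mult.left_commute)
qed

lemma
  fixes P :: "'a::euclidean_space \<Rightarrow> real"
  assumes C2: "C2 P" and r: "r \<ge> 0"
  shows integrable_bump_sq_laplacian: "integrable lborel (\<lambda>x. (bump r x)\<^sup>2 * laplacian P x)"
    and integrable_bump_radial: "integrable lborel (\<lambda>x. bump r x * (x \<bullet> grad P x))"
    and integral_bump_sq_laplacian:
      "(\<integral>x. (bump r x)\<^sup>2 * laplacian P x \<partial>lborel) = 4 * (\<integral>x. bump r x * (x \<bullet> grad P x) \<partial>lborel)"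
proof -
  note cont [continuous_intros] = C2_continuous[OF C2]
  have out: "bump r x = 0" if "norm x > sqrt r" for x :: 'a
    using that r by (intro bump_eq_0) (simp add: real_less_lsqrt sqrt_le_D)
  show i1: "integrable lborel (\<lambda>x. (bump r x)\<^sup>2 * laplacian P x)"
    by (rule compact_support_ball_integrable[where R="sqrt r"]) (auto simp: out intro!: continuous_intros)
  show i2: "integrable lborel (\<lambda>x. bump r x * (x \<bullet> grad P x))"
    by (rule compact_support_ball_integrable[where R="sqrt r"]) (auto simp: out intro!: continuous_intros)
  define F where "F b = (\<lambda>x. (bump r x)\<^sup>2 * dderiv b P x)" for b
  define F' where "F' b v = (\<lambda>x. (bump r x)\<^sup>2 * dderiv v (dderiv b P) x - 4 * bump r x * (x \<bullet> v) * dderiv b P x)" for b v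
  have dF: "(F b has_derivative (\<lambda>v. F' b v x)) (at x)" for b x
    unfolding F_def F'_def
    by (rule has_derivative_eq_rhs[OF has_derivative_mult[OF has_derivative_bump_sq C2_has_derivative(2)[OF C2]]])
      (simp add: algebra_simps)
  have F'eq: "dderiv v (F b) = F' b v" for b v
    using dF dderiv_eqI by blast
  have "integral\<^sup>L lborel (dderiv b (F b)) = 0" for b
  proof (rule integral_dderiv_compact_support[where R="sqrt r"])
    show "(F b has_derivative (\<lambda>v. dderiv v (F b) x)) (at x)" for x using dF by (simp add: F'eq)
    show "continuous_on UNIV (dderiv b (F b))" unfolding F'eq unfolding F'_def by (intro continuous_intros)
    show "sqrt r < norm x \<Longrightarrow> F b x = 0" for x by (simp add: F_def out)
  qed
  then have z: "integral\<^sup>L lborel (F' b b) = 0" for b by (simp add: F'eq)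
  have i3: "integrable lborel (F' b b)" for b unfolding F'_def
    by (rule compact_support_ball_integrable[where R="sqrt r"]) (auto simp: out intro!: continuous_intros)
  have "(\<Sum>b\<in>Basis. F' b b x) = (bump r x)\<^sup>2 * laplacian P x - 4 * (bump r x * (x \<bullet> grad P x))" for x
    by (simp add: F'_def sum_subtractf laplacian_def grad_def inner_sum_right sum_distrib_left algebra_simps)
  then have "(\<integral>x. (bump r x)\<^sup>2 * laplacian P x - 4 * (bump r x * (x \<bullet> grad P x)) \<partial>lborel)
      = (\<integral>x. (\<Sum>b\<in>Basis. F' b b x) \<partial>lborel)" by simp
  also have "\<dots> = 0" using z i3 by simp
  finally show "(\<integral>x. (bump r x)\<^sup>2 * laplacian P x \<partial>lborel) = 4 * (\<integral>x. bump r x * (x \<bullet> grad P x) \<partial>lborel)"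
    using i1 i2 by simp
qed

text \<open>
  The weighted mean \<open>M s\<close> of \<open>P\<close> over the ball of radius \<open>s\<close> around \<open>z\<close> is nonincreasing in \<open>s\<close>: its derivative
  is the mean of the radial derivative of \<open>P\<close>, which \<open>integral_bump_sq_laplacian\<close> converts
  into an integral of the Laplacian against a nonnegative weight.
\<close>

lemma superharmonic_mean_value:
  fixes P :: "'a::euclidean_space \<Rightarrow> real"
  assumes C2: "C2 P" and sup: "\<And>x. laplacian P x \<le> 0" and s: "s \<ge> 0"
  shows "(\<integral>y. bump 1 y * P (z + s *\<^sub>R y) \<partial>lborel) \<le> P z * (\<integral>y. bump 1 (y::'a) \<partial>lborel)"
proof -
  note cont = C2_continuous[OF C2]
  obtain a where a: "cball 0 1 \<subseteq> cbox (-a) (a::'a)"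
    using bounded_subset_cbox_symmetric[OF bounded_cball] by blast
  have out: "bump 1 y = 0" if "y \<notin> cbox (-a) a" for y
    using that a by (intro bump_eq_0 one_le_power) force
  define M where "M s = integral (cbox (-a) a) (\<lambda>y. bump 1 y * P (z + s *\<^sub>R y))" for s
  have cM: "continuous_on UNIV (\<lambda>y. bump 1 y * P (z + s *\<^sub>R y))" for s
    by (intro continuous_intros continuous_on_compose2[OF cont(1)]) auto
  have M: "M s = (\<integral>y. bump 1 y * P (z + s *\<^sub>R y) \<partial>lborel)" for s
    unfolding M_def by (rule compact_support_integrable(2)[OF cM]) (simp add: out)
  define M' where "M' s = integral (cbox (-a) a) (\<lambda>y. bump 1 y * (y \<bullet> grad P (z + s *\<^sub>R y)))" for s
  have dM: "(M has_real_derivative M' s) (at s)" for s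
    unfolding M_def[abs_def] M'_def
  proof (rule leibniz_rule_field_derivative)
    show "((\<lambda>s. bump 1 y * P (z + s *\<^sub>R y)) has_real_derivative bump 1 y * (y \<bullet> grad P (z + s *\<^sub>R y))) (at s)" for y s
    proof (rule DERIV_cmult)
      show "((\<lambda>s. P (z + s *\<^sub>R y)) has_real_derivative y \<bullet> grad P (z + s *\<^sub>R y)) (at s)"
        using has_field_derivative_along_line[OF C2_has_derivative(1)[OF C2], of z y s]
        by (simp add: C2_grad[OF C2] inner_commute)
    qed
    show "(\<lambda>y. bump 1 y * P (z + s *\<^sub>R y)) integrable_on cbox (-a) a" for s
      by (intro integrable_continuous continuous_on_subset[OF cM]) auto
    show "continuous_on (UNIV \<times> cbox (-a) a) (\<lambda>(s, y). bump 1 y * (y \<bullet> grad P (z + s *\<^sub>R y)))"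
      unfolding split_beta by (intro continuous_on_compose2[OF cont(4)] continuous_intros) auto
  qed auto
  have M'le: "M' s \<le> 0" if "s > 0" for s
  proof -
    let ?Q = "\<lambda>y. P (z + s *\<^sub>R y)"
    have cont': "continuous_on UNIV (\<lambda>y. bump 1 y * (y \<bullet> grad P (z + s *\<^sub>R y)))"
      by (intro continuous_on_compose2[OF cont(4)] continuous_intros) auto
    have "s * M' s = (\<integral>y. s * (bump 1 y * (y \<bullet> grad P (z + s *\<^sub>R y))) \<partial>lborel)"
      unfolding M'_def
      by (subst compact_support_integrable(2)[OF cont']) (auto simp: out)
    also have "\<dots> = (\<integral>y. bump 1 y * (y \<bullet> grad ?Q y) \<partial>lborel)"
      by (simp add: grad_affine[OF C2] mult_ac)
    also have "4 * \<dots> = (\<integral>y. (bump 1 y)\<^sup>2 * laplacian ?Q y \<partial>lborel)"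
      using integral_bump_sq_laplacian[OF C2_affine[OF C2]] by simp
    also have "\<dots> \<le> 0"
    proof -
      have "(\<integral>y. (bump 1 y)\<^sup>2 * laplacian ?Q y \<partial>lborel) \<le> (\<integral>y. 0 \<partial>(lborel :: 'a measure))"
        by (rule integral_mono[OF integrable_bump_sq_laplacian[OF C2_affine[OF C2]]])
          (auto simp: laplacian_affine[OF C2] intro!: mult_nonneg_nonpos sup)
      then show ?thesis by simp
    qed
    finally show ?thesis using that by (simp add: mult_le_0_iff)
  qed
  have "M s \<le> M 0"
  proof (rule DERIV_nonpos_imp_decreasing_open[OF s])
    show "\<exists>y. (M has_real_derivative y) (at x) \<and> y \<le> 0" if "0 < x" for x using dM M'le that by blast
    show "continuous_on {0..s} M" using dM by (meson DERIV_continuous_on has_field_derivative_at_within)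
  qed
  then show ?thesis by (simp add: M mult.commute)
qed


text \<open>
  With \<open>P = exp (f/4)\<close> one has \<open>\<Delta>P \<le> - P |\<nabla>f|\<^sup>2 / 16\<close>. The ball of radius \<open>3\<close> around the boundary point \<open>z\<close>
  contains the ball of radius \<open>2\<close> around the origin, so the mean value inequality at \<open>z\<close> with radius \<open>4\<close>
  bounds the integral of \<open>P\<close> over that ball by a multiple of \<open>P z\<close>. Testing the inequality for \<open>\<Delta>P\<close> with a cut-off
  that is supported there and absorbing the gradient of the cut-off bounds the integral of \<open>P |\<nabla>f|\<^sup>2\<close> over the unit ball.
  The constant depends on the dimension only, which is what makes the estimate usable at all scales.
\<close>

lemma weak_Harnack_unit_ball:
  "\<exists>C\<ge>0. \<forall>(f::'a::euclidean_space \<Rightarrow> real) z. C2 f \<longrightarrow> (\<forall>x. laplacian f x \<le> - (norm (grad f x))\<^sup>2 / 2) \<longrightarrow> norm z = 1 \<longrightarrow>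
     (\<integral>\<^sup>+y. ennreal (exp (f y / 4) * (1 + (norm (grad f y))\<^sup>2)) * indicator (cball 0 1) y \<partial>lborel)
       \<le> ennreal (C * exp (f z / 4))"
proof -
  define \<beta> where "\<beta> = (\<integral>y. bump 1 (y::'a) \<partial>lborel)"
  define C where "C = 300 * 4 ^ DIM('a) * \<beta>"
  have "\<beta> \<ge> 0" unfolding \<beta>_def by (simp add: bump_nonneg)
  then have C0: "C \<ge> 0" by (simp add: C_def)
  have "(\<integral>\<^sup>+y. ennreal (exp (f y / 4) * (1 + (norm (grad f y))\<^sup>2)) * indicator (cball 0 1) y \<partial>lborel)
       \<le> ennreal (C * exp (f z / 4))"
    if C2: "C2 f" and lap: "\<And>x. laplacian f x \<le> - (norm (grad f x))\<^sup>2 / 2" and z: "norm z = 1"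
    for f :: "'a \<Rightarrow> real" and z
  proof -
    define P where "P x = exp (1/4 * f x)" for x
    have Ppos: "P x > 0" for x by (simp add: P_def)
    have PC2: "C2 P" unfolding P_def[abs_def] by (rule C2_exp[OF C2])
    have gradP: "grad P x = (P x / 4) *\<^sub>R grad f x" for x
      unfolding P_def[abs_def] by (subst grad_exp[OF C2]) simp
    have lapP: "laplacian P x \<le> - (P x * (norm (grad f x))\<^sup>2 / 16)" for x
    proof -
      have "laplacian P x = P x * (1/4 * laplacian f x + (1/4)\<^sup>2 * (norm (grad f x))\<^sup>2)"
        unfolding P_def[abs_def] by (subst laplacian_exp[OF C2]) simp
      also have "\<dots> \<le> P x * (- ((norm (grad f x))\<^sup>2 / 16))"
        using lap[of x] Ppos[of x] by (intro mult_left_mono) (auto simp: power2_eq_square)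
      finally show ?thesis by simp
    qed
    note cont [continuous_intros] = C2_continuous[OF PC2] C2_continuous[OF C2]
    \<comment> \<open>The averaging weight of the mean value inequality at \<open>z\<close> with radius \<open>4\<close>.\<close>
    define H where "H x = bump 1 ((1/4) *\<^sub>R (x - z))" for x
    have H0: "H x \<ge> 0" for x by (simp add: H_def bump_nonneg)
    have H1: "H x \<ge> 7/16" if "norm x \<le> 2" for x
    proof -
      have "norm (x - z) \<le> 3" using norm_triangle_ineq4[of x z] that z by simp
      then have "(norm ((1/4) *\<^sub>R (x - z)))\<^sup>2 \<le> (3/4)\<^sup>2" by (intro power_mono) auto
      then show ?thesis using bump_ge[of 1 "(1/4) *\<^sub>R (x - z)"] unfolding H_def by (simp add: power2_eq_square)
    qed
    have cH: "continuous_on UNIV (\<lambda>x. H x * P x)" unfolding H_def by (intro continuous_intros)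
    have iH: "integrable lborel (\<lambda>x. H x * P x)"
    proof (rule compact_support_ball_integrable[OF cH, where R=5])
      fix x :: 'a assume "5 < norm x"
      then have "norm (x - z) > 4" using z norm_triangle_sub[of x z] by simp
      then have "(norm ((1/4) *\<^sub>R (x - z)))\<^sup>2 \<ge> 1" by (intro one_le_power) auto
      then show "H x * P x = 0" by (simp add: H_def bump_eq_0)
    qed
    have "(\<integral>x. H x * P x \<partial>lborel) = 4 ^ DIM('a) * (\<integral>y. bump 1 y * P (z + 4 *\<^sub>R y) \<partial>lborel)"
      by (subst integral_lborel_affine[OF cH, of 4 z]) (simp_all add: H_def)
    also have "\<dots> \<le> 4 ^ DIM('a) * (P z * \<beta>)"
      unfolding \<beta>_def
    proof (intro mult_left_mono superharmonic_mean_value PC2)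
      show "laplacian P x \<le> 0" for x
        by (rule order_trans[OF lapP]) (simp add: less_imp_le Ppos)
    qed auto
    finally have intH: "(\<integral>x. H x * P x \<partial>lborel) \<le> 4 ^ DIM('a) * \<beta> * P z" by (simp add: mult_ac)
    \<comment> \<open>The energy density, cut off on the ball of radius \<open>2\<close>.\<close>
    define G where "G x = (bump 4 x)\<^sup>2 * (P x * (norm (grad f x))\<^sup>2)" for x :: 'a
    have out: "bump 4 x = 0" if "norm x > 2" for x :: 'a
    proof -
      have "(norm x)\<^sup>2 \<ge> 2\<^sup>2" using that by (intro power_mono) auto
      then show ?thesis by (intro bump_eq_0) simp
    qed
    have iG: "integrable lborel G" unfolding G_def
      by (rule compact_support_ball_integrable[where R=2]) (auto simp: out intro!: continuous_intros)
    have pt: "(bump 4 x)\<^sup>2 * laplacian P x - 4 * (bump 4 x * (x \<bullet> grad P x)) \<le> - (1/32) * G x + 80 * (H x * P x)" for x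
    proof (cases "norm x > 2")
      case True then show ?thesis using out[of x] H0[of x] Ppos[of x] by (simp add: G_def)
    next
      case False
      let ?b = "bump 4 x" and ?n = "norm (grad f x)"
      have "?b\<^sup>2 * laplacian P x \<le> ?b\<^sup>2 * (- (P x * ?n\<^sup>2 / 16))" by (intro mult_left_mono lapP) simp
      then have 1: "?b\<^sup>2 * laplacian P x \<le> - (1/16) * G x" by (simp add: G_def)
      have "\<bar>x \<bullet> grad f x\<bar> \<le> 2 * ?n"
        using Cauchy_Schwarz_ineq2[of x "grad f x"] mult_right_mono[of "norm x" 2 ?n] False by simp
      then have "- (x \<bullet> grad f x) * (?b * P x) \<le> (2 * ?n) * (?b * P x)"
        by (intro mult_right_mono) (auto simp: bump_nonneg less_imp_le Ppos)
      then have 2: "- 4 * (?b * (x \<bullet> grad P x)) \<le> 2 * ?b * ?n * P x" by (simp add: gradP algebra_simps)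
      \<comment> \<open>Half of the energy absorbs the term in which the cut-off is differentiated.\<close>
      have "0 \<le> (?b * ?n - 32)\<^sup>2 * P x" using Ppos[of x] by simp
      then have 3: "2 * ?b * ?n * P x \<le> (1/32) * G x + 32 * P x"
        by (simp add: G_def power2_eq_square algebra_simps)
      have 4: "32 * P x \<le> 80 * (H x * P x)"
        using mult_right_mono[OF H1[of x], of "80 * P x"] False Ppos[of x] by simp
      show ?thesis using 1 2 3 4 by linarith
    qed
    have "0 = (\<integral>x. (bump 4 x)\<^sup>2 * laplacian P x - 4 * (bump 4 x * (x \<bullet> grad P x)) \<partial>lborel)"
      using integral_bump_sq_laplacian[OF PC2, of 4] integrable_bump_sq_laplacian[OF PC2, of 4]
        integrable_bump_radial[OF PC2, of 4] by simp
    also have "\<dots> \<le> (\<integral>x. - (1/32) * G x + 80 * (H x * P x) \<partial>lborel)"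
      using iG iH integrable_bump_sq_laplacian[OF PC2, of 4] integrable_bump_radial[OF PC2, of 4] pt
      by (intro integral_mono) auto
    also have "\<dots> = - (1/32) * integral\<^sup>L lborel G + 80 * (\<integral>x. H x * P x \<partial>lborel)"
      using iG iH by simp
    finally have intG: "integral\<^sup>L lborel G \<le> 2560 * (\<integral>x. H x * P x \<partial>lborel)" by simp
    have "(\<integral>\<^sup>+y. ennreal (exp (f y / 4) * (1 + (norm (grad f y))\<^sup>2)) * indicator (cball 0 1) y \<partial>lborel)
       \<le> (\<integral>\<^sup>+y. ennreal (3 * (H y * P y) + (1/9) * G y) \<partial>lborel)"
    proof (intro nn_integral_mono)
      fix y :: 'a
      show "ennreal (exp (f y / 4) * (1 + (norm (grad f y))\<^sup>2)) * indicator (cball 0 1) y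
        \<le> ennreal (3 * (H y * P y) + (1/9) * G y)"
      proof (cases "norm y \<le> 1")
        case True
        have "P y \<le> 3 * (H y * P y)"
          using mult_right_mono[OF H1[of y], of "3 * P y"] True Ppos[of y] by simp
        moreover have "(norm y)\<^sup>2 \<le> 1" using True by (simp add: power_le_one)
        then have "bump 4 y \<ge> 3" using bump_ge[of 4 y] by simp
        then have "(bump 4 y)\<^sup>2 \<ge> 3\<^sup>2" by (intro power_mono) auto
        then have "9 * (P y * (norm (grad f y))\<^sup>2) \<le> G y"
          unfolding G_def using Ppos[of y] by (intro mult_right_mono) auto
        ultimately have "P y * (1 + (norm (grad f y))\<^sup>2) \<le> 3 * (H y * P y) + (1/9) * G y"
          by (simp add: distrib_left)
        then show ?thesis using True by (simp add: P_def ennreal_leI)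
      qed simp
    qed
    also have "\<dots> = ennreal (\<integral>y. 3 * (H y * P y) + (1/9) * G y \<partial>lborel)"
      proof (rule nn_integral_eq_integral)
      show "AE y in lborel. 0 \<le> 3 * (H y * P y) + (1/9) * G y"
        using H0 Ppos by (auto simp: G_def less_imp_le)
    qed (use iG iH in simp)
    also have "\<dots> \<le> ennreal (C * exp (f z / 4))"
    proof (rule ennreal_leI)
      have "0 \<le> (\<integral>x. H x * P x \<partial>lborel)" using H0 Ppos by (intro integral_nonneg_AE) (auto simp: less_imp_le)
      then have "(\<integral>y. 3 * (H y * P y) + (1/9) * G y \<partial>lborel) \<le> 300 * (\<integral>x. H x * P x \<partial>lborel)"
        using iG iH intG by simp
      also have "\<dots> \<le> C * P z" using intH by (simp add: C_def)
      finally show "(\<integral>y. 3 * (H y * P y) + (1/9) * G y \<partial>lborel) \<le> C * exp (f z / 4)" by (simp add: P_def)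
    qed
    finally show ?thesis .
  qed
  then show ?thesis using C0 by blast
qed

section \<open>A ray along which the conformal factor decays\<close>

lemma bounded_of_integrable_derivative:
  fixes h h' k :: "real \<Rightarrow> real"
  assumes der: "\<And>t. t \<ge> T \<Longrightarrow> (h has_real_derivative h' t) (at t)"
    and cont: "\<And>t. t \<ge> T \<Longrightarrow> isCont h' t" "\<And>t. t \<ge> T \<Longrightarrow> isCont k t"
    and le: "\<And>t. t \<ge> T \<Longrightarrow> \<bar>h' t\<bar> \<le> k t"
    and fin: "(\<integral>\<^sup>+t. ennreal (k t) * indicator {T..} t \<partial>lborel) < \<infinity>"
  shows "\<exists>B. \<forall>t\<ge>T. h t \<le> B"
proof -
  define E where "E = enn2real (\<integral>\<^sup>+t. ennreal (k t) * indicator {T..} t \<partial>lborel)"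
  have "h t \<le> h T + E" if "t \<ge> T" for t
  proof -
    have i: "integrable lborel (\<lambda>s. h' s * indicator {T..t} s)" "integrable lborel (\<lambda>s. k s * indicator {T..t} s)"
      using cont by (auto intro!: borel_integrable_atLeastAtMost)
    have k0: "0 \<le> k s * indicator {T..t} s" for s
      using le[of s] by (auto simp: indicator_def)
    have "h t - h T = (\<integral>s. h' s * indicator {T..t} s \<partial>lborel)"
      using that by (intro integral_FTC_Icc_real[symmetric] der cont) auto
    also have "\<dots> \<le> (\<integral>s. k s * indicator {T..t} s \<partial>lborel)"
      by (rule integral_mono[OF i]) (use le in \<open>force simp: indicator_def\<close>)
    also have "\<dots> \<le> E"
    proof -
      have "ennreal (\<integral>s. k s * indicator {T..t} s \<partial>lborel) = (\<integral>\<^sup>+s. ennreal (k s * indicator {T..t} s) \<partial>lborel)"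
        by (rule nn_integral_eq_integral[symmetric, OF i(2)]) (use k0 in auto)
      also have "\<dots> \<le> (\<integral>\<^sup>+s. ennreal (k s) * indicator {T..} s \<partial>lborel)"
        by (intro nn_integral_mono) (auto simp: indicator_def)
      also have "\<dots> = ennreal E" using fin by (simp add: E_def)
      finally show ?thesis by (simp add: E_def)
    qed
    finally show ?thesis by simp
  qed
  then show ?thesis by blast
qed

text \<open>
  Scaling the estimate on the unit ball to radius \<open>t\<close> bounds the integral of
  \<open>P (1 + t\<^sup>2 |\<nabla>f|\<^sup>2)\<close> at \<open>x0 + t y\<close> over \<open>y\<close> in the unit ball by a multiple of \<open>t powr (-3/8)\<close>, where \<open>P = exp (f/4)\<close>.
  After multiplication by \<open>t powr (-11/16)\<close> this is integrable over \<open>t \<ge> T\<close>, since \<open>11/16 + 3/8 = 17/16 > 1\<close>.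
  Exchanging the integrals gives a direction \<open>y\<close> for which the inner integral over \<open>t\<close> is finite. It
  dominates the total variation of \<open>t powr (5/16) * P\<close> along the ray, which is therefore bounded; the
  fourth power of this bound is the claim, as \<open>4 * 5/16 = 5/4\<close>.
  The rays are parametrised by \<open>y\<close> in a ball instead of a sphere, which makes the inner integrals over \<open>y\<close>
  rescaled Lebesgue integrals.
\<close>

lemma exists_thin_ray:
  fixes f :: "'a::euclidean_space \<Rightarrow> real"
  assumes C2: "C2 f" and lap: "\<And>x. laplacian f x \<le> - (norm (grad f x))\<^sup>2 / 2"
    and T: "T \<ge> 1" and K: "K \<ge> 0"
    and decay: "\<And>t. t \<ge> T \<Longrightarrow> \<exists>z. norm (z - x0) = t \<and> exp (f z / 4) \<le> K * t powr (-3/8)"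
  shows "\<exists>y K'. y \<noteq> 0 \<and> (\<forall>t\<ge>T. exp (f (x0 + t *\<^sub>R y)) \<le> K' * t powr (-5/4))"
proof -
  note cont = C2_continuous[OF C2]
  have [measurable]: "f \<in> borel_measurable borel" "grad f \<in> borel_measurable borel"
    using cont by (auto intro: borel_measurable_continuous_onI)
  have [measurable]: "cball (0::'a) 1 \<in> sets borel" by simp
  obtain C where C0: "C \<ge> 0" and C: "\<And>(f::'a \<Rightarrow> real) z. C2 f \<Longrightarrow> (\<And>x. laplacian f x \<le> - (norm (grad f x))\<^sup>2 / 2) \<Longrightarrow> norm z = 1 \<Longrightarrow>
     (\<integral>\<^sup>+y. ennreal (exp (f y / 4) * (1 + (norm (grad f y))\<^sup>2)) * indicator (cball 0 1) y \<partial>lborel)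
       \<le> ennreal (C * exp (f z / 4))"
    using weak_Harnack_unit_ball[where 'a='a] by blast
  define e where "e t y = exp (f (x0 + t *\<^sub>R y) / 4) * (1 + (t * norm (grad f (x0 + t *\<^sub>R y)))\<^sup>2)" for t y
  have e0: "e t y \<ge> 0" for t y by (simp add: e_def)
  have slice: "(\<integral>\<^sup>+y. ennreal (e t y) * indicator (cball 0 1) y \<partial>lborel) \<le> ennreal (C * K * t powr (-3/8))" if "t \<ge> T" for t
  proof -
    have t: "t > 0" using that T by simp
    obtain z where z: "norm (z - x0) = t" "exp (f z / 4) \<le> K * t powr (-3/8)" using decay[OF \<open>t \<ge> T\<close>] by blast
    let ?F = "\<lambda>y. f (x0 + t *\<^sub>R y)"
    have "(\<integral>\<^sup>+y. ennreal (exp (?F y / 4) * (1 + (norm (grad ?F y))\<^sup>2)) * indicator (cball 0 1) y \<partial>lborel)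
       \<le> ennreal (C * exp (?F ((z - x0) /\<^sub>R t) / 4))"
    proof (rule C)
      show "C2 ?F" by (rule C2_affine[OF C2])
      show "laplacian ?F y \<le> - (norm (grad ?F y))\<^sup>2 / 2" for y
        using mult_left_mono[OF lap[of "x0 + t *\<^sub>R y"], of "t\<^sup>2"]
        by (simp add: laplacian_affine[OF C2] grad_affine[OF C2] power_mult_distrib)
      show "norm ((z - x0) /\<^sub>R t) = 1" using z t by simp
    qed
    also have "?F ((z - x0) /\<^sub>R t) = f z" using t by simp
    also have "ennreal (C * exp (f z / 4)) \<le> ennreal (C * K * t powr (-3/8))"
      using mult_left_mono[OF z(2) C0] by (intro ennreal_leI) (simp add: mult.assoc)
    finally show ?thesis using t by (simp add: e_def grad_affine[OF C2])
  qed
  define w where "w t y = ennreal (t powr (-11/16) * e t y) * indicator {T..} t * indicator (cball 0 1) y" for t y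
  have [measurable]: "case_prod w \<in> borel_measurable (lborel \<Otimes>\<^sub>M lborel)"
    unfolding w_def e_def by measurable
  have "(\<integral>\<^sup>+y. (\<integral>\<^sup>+t. w t y \<partial>lborel) \<partial>lborel) = (\<integral>\<^sup>+t. (\<integral>\<^sup>+y. w t y \<partial>lborel) \<partial>lborel)"
    by (rule lborel_pair.Fubini') measurable
  also have "\<dots> \<le> (\<integral>\<^sup>+t. ennreal (C * K * t powr (-17/16)) * indicator {T..} t \<partial>lborel)"
  proof (rule nn_integral_mono)
    fix t :: real
    show "(\<integral>\<^sup>+y. w t y \<partial>lborel) \<le> ennreal (C * K * t powr (-17/16)) * indicator {T..} t"
    proof (cases "t \<ge> T")
      case True
      have "(\<integral>\<^sup>+y. w t y \<partial>lborel) = (\<integral>\<^sup>+y. ennreal (t powr (-11/16)) * (ennreal (e t y) * indicator (cball 0 1) y) \<partial>lborel)"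
        using True by (simp add: w_def ennreal_mult e0 mult.assoc)
      also have "\<dots> = ennreal (t powr (-11/16)) * (\<integral>\<^sup>+y. ennreal (e t y) * indicator (cball 0 1) y \<partial>lborel)"
        unfolding e_def by (rule nn_integral_cmult) measurable
      also have "\<dots> \<le> ennreal (t powr (-11/16)) * ennreal (C * K * t powr (-3/8))"
        by (intro mult_left_mono slice True) auto
      also have "\<dots> = ennreal (C * K * (t powr (-11/16) * t powr (-3/8)))"
        using C0 K by (subst ennreal_mult[symmetric]) (auto simp: mult_ac)
      also have "t powr (-11/16) * t powr (-3/8) = t powr (-17/16)"
        by (simp add: powr_add[symmetric])
      finally show ?thesis using True by simp
    qed (simp add: w_def)
  qed
  also have "\<dots> = ennreal (0 - (C * K * (- 16 * T powr (-1/16))))"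
  proof (rule nn_integral_FTC_atLeast)
    show "((\<lambda>t. C * K * (- 16 * t powr (-1/16))) has_real_derivative C * K * t powr (-17/16)) (at t)" if "T \<le> t" for t
    proof -
      have "((\<lambda>t. t powr (-1/16)) has_real_derivative (-1/16) * t powr (-17/16)) (at t)"
        using has_real_derivative_powr[of t "-1/16"] that T by simp
      from DERIV_cmult[OF this, of "C * K * (-16)"] show ?thesis by (simp add: mult.assoc)
    qed
    have "((\<lambda>t::real. t powr (-1/16)) \<longlongrightarrow> 0) at_top" by (intro tendsto_neg_powr filterlim_ident) auto
    from tendsto_mult_right_zero[OF this, of "C * K * (-16)"]
    show "((\<lambda>t. C * K * (- 16 * t powr (-1/16))) \<longlongrightarrow> 0) at_top" by (simp add: mult.assoc)
  qed (use C0 K in auto)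
  finally have "(\<integral>\<^sup>+y. (\<integral>\<^sup>+t. w t y \<partial>lborel) \<partial>lborel) \<noteq> \<infinity>" by (auto simp: top_unique)
  then have "AE y in lborel. (\<integral>\<^sup>+t. w t y \<partial>lborel) \<noteq> \<infinity>"
    by (intro nn_integral_PInf_AE) measurable
  then have ae: "AE y in lborel. y \<noteq> 0 \<and> (\<integral>\<^sup>+t. w t y \<partial>lborel) \<noteq> \<infinity>"
    using AE_lborel_singleton[of "0::'a"] by eventually_elim auto
  obtain y where y: "y \<in> cball 0 1" "y \<noteq> 0" "(\<integral>\<^sup>+t. w t y \<partial>lborel) \<noteq> \<infinity>"
  proof (rule ccontr)
    assume "\<not> thesis"
    then have "AE y in lborel. y \<notin> cball (0::'a) 1" using ae that by (auto elim: eventually_mono)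
    then have "emeasure lborel (cball (0::'a) 1) = 0"
      by (subst (asm) AE_iff_measurable[of "cball 0 1"]) (auto simp: set_eq_iff)
    then show False using content_cball_pos[of 1 "0::'a"] by (simp add: measure_def)
  qed
  define p where "p t = exp (f (x0 + t *\<^sub>R y) / 4)" for t
  define h where "h t = t powr (5/16) * p t" for t
  define h' where "h' t = 5/16 * t powr (-11/16) * p t + t powr (5/16) * (p t * (dderiv y f (x0 + t *\<^sub>R y) / 4))" for t
  have "\<exists>B. \<forall>t\<ge>T. h t \<le> B"
  proof (rule bounded_of_integrable_derivative[where h'=h' and k="\<lambda>t. t powr (-11/16) * e t y"])
    fix t assume t: "t \<ge> T"
    have tp: "t > 0" using t T by simp
    have df: "((\<lambda>t. f (x0 + t *\<^sub>R y)) has_real_derivative dderiv y f (x0 + t *\<^sub>R y)) (at t)"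
      by (rule has_field_derivative_along_line[OF C2_has_derivative(1)[OF C2]])
    have dp: "(p has_real_derivative p t * (dderiv y f (x0 + t *\<^sub>R y) / 4)) (at t)"
      unfolding p_def by (auto intro!: derivative_eq_intros df)
    have "((\<lambda>t. t powr (5/16)) has_real_derivative 5/16 * t powr (-11/16)) (at t)"
      using tp has_real_derivative_powr[of t "5/16"] by simp
    from DERIV_mult[OF this dp]
    show "(h has_real_derivative h' t) (at t)"
      unfolding h_def h'_def by (simp add: algebra_simps)
    have "continuous_on UNIV (\<lambda>t. f (x0 + t *\<^sub>R y))"
        "continuous_on UNIV (\<lambda>t. dderiv y f (x0 + t *\<^sub>R y))"
        "continuous_on UNIV (\<lambda>t. grad f (x0 + t *\<^sub>R y))"
      by (intro continuous_on_compose2[OF cont(1)] continuous_on_compose2[OF cont(2)]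
          continuous_on_compose2[OF cont(4)] continuous_intros; simp)+
    then have line: "isCont (\<lambda>t. f (x0 + t *\<^sub>R y)) t" "isCont (\<lambda>t. dderiv y f (x0 + t *\<^sub>R y)) t"
        "isCont (\<lambda>t. grad f (x0 + t *\<^sub>R y)) t"
      by (simp_all add: continuous_on_eq_continuous_at)
    show "isCont h' t" unfolding h'_def p_def
      using tp by (intro continuous_intros line) auto
    show "isCont (\<lambda>t. t powr (-11/16) * e t y) t" unfolding e_def
      using tp by (intro continuous_intros line) auto
    have "\<bar>dderiv y f (x0 + t *\<^sub>R y)\<bar> \<le> norm (grad f (x0 + t *\<^sub>R y))"
      unfolding C2_grad[OF C2]
      using Cauchy_Schwarz_ineq2[of "grad f (x0 + t *\<^sub>R y)" y]
        mult_left_mono[of "norm y" 1 "norm (grad f (x0 + t *\<^sub>R y))"] y(1) by simp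
    then have d: "t * \<bar>dderiv y f (x0 + t *\<^sub>R y)\<bar> \<le> t * norm (grad f (x0 + t *\<^sub>R y))" (is "?a \<le> ?b")
      using tp by simp
    have "t powr (5/16) = t powr (-11/16) * t"
      using tp powr_add[of t "-11/16" 1] by simp
    then have "h' t = t powr (-11/16) * p t * (5/16 + t * dderiv y f (x0 + t *\<^sub>R y) / 4)"
      unfolding h'_def by (simp add: algebra_simps)
    then have "\<bar>h' t\<bar> = t powr (-11/16) * p t * \<bar>5/16 + t * dderiv y f (x0 + t *\<^sub>R y) / 4\<bar>"
      by (simp add: abs_mult p_def)
    also have "\<dots> \<le> t powr (-11/16) * p t * (1 + ?b\<^sup>2)"
    proof (intro mult_left_mono)
      have "\<bar>5/16 + t * dderiv y f (x0 + t *\<^sub>R y) / 4\<bar> \<le> 5/16 + ?a / 4"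
        using abs_triangle_ineq[of "5/16" "t * dderiv y f (x0 + t *\<^sub>R y) / 4"] tp by (simp add: abs_mult)
      \<comment> \<open>Completing the square: \<open>b/4 \<le> b\<^sup>2 + 1/64\<close>.\<close>
      also have "\<dots> \<le> 1 + ?b\<^sup>2" using d zero_le_power2[of "?b - 1/8"] by (simp add: power2_eq_square algebra_simps)
      finally show "\<bar>5/16 + t * dderiv y f (x0 + t *\<^sub>R y) / 4\<bar> \<le> 1 + ?b\<^sup>2" .
    qed (simp add: p_def)
    finally show "\<bar>h' t\<bar> \<le> t powr (-11/16) * e t y" by (simp add: e_def p_def mult.assoc)
  next
    show "(\<integral>\<^sup>+t. ennreal (t powr (-11/16) * e t y) * indicator {T..} t \<partial>lborel) < \<infinity>"
      using y by (simp add: w_def less_top)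
  qed
  then obtain B where B: "\<And>t. t \<ge> T \<Longrightarrow> h t \<le> B" by blast
  have "exp (f (x0 + t *\<^sub>R y)) \<le> B ^ 4 * t powr (-5/4)" if "t \<ge> T" for t
  proof -
    have tp: "t > 0" using that T by simp
    have h0: "0 \<le> h t" by (simp add: h_def p_def)
    have "exp (f (x0 + t *\<^sub>R y)) = p t ^ 4" by (simp add: p_def exp_of_nat_mult[symmetric])
    also have "p t = h t * t powr (-5/16)"
      using tp by (simp add: h_def powr_minus field_simps)
    also have "(h t * t powr (-5/16)) ^ 4 = h t ^ 4 * t powr (-5/4)"
      using tp by (simp add: power_mult_distrib powr_power)
    also have "\<dots> \<le> B ^ 4 * t powr (-5/4)"
      using h0 B[OF that] by (intro mult_right_mono power_mono) auto
    finally show ?thesis .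
  qed
  then show ?thesis using y(2) by (intro exI[of _ y] exI[of _ "B ^ 4"]) auto
qed

section \<open>Length and distance of a conformally flat metric\<close>

context
  fixes g :: "real^'n::finite \<Rightarrow> real^'n^'n" and f :: "real^'n \<Rightarrow> real"
  assumes cont: "continuous_on UNIV f" and g: "\<And>x. g x = exp (2 * f x) *\<^sub>R mat 1"
begin

lemma curve_speed_conformal:
  "curve_speed g \<gamma> t = exp (f (\<gamma> t)) * norm (vector_derivative \<gamma> (at t))"
proof -
  have "exp (2 * f x) = (exp (f x))\<^sup>2" for x by (simp add: exp_double)
  then show ?thesis
    by (simp add: curve_speed_def g scaleR_matrix_vector_assoc[symmetric] real_sqrt_mult norm_eq_sqrt_inner)
qed

lemma linepath_speed:
  "curve_speed g (linepath a b) t = exp (f (linepath a b t)) * norm (b - a)"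
  by (simp add: curve_speed_conformal vector_derivative_linepath_at)

lemma linepath_speed_integrable: "curve_speed g (linepath a b) integrable_on {0..1}"
proof -
  have "continuous_on {0..1} (\<lambda>t. exp (f (linepath a b t)) * norm (b - a))"
    by (intro continuous_intros continuous_on_compose2[OF cont]) auto
  moreover have "curve_speed g (linepath a b) = (\<lambda>t. exp (f (linepath a b t)) * norm (b - a))"
    by (rule ext) (rule linepath_speed)
  ultimately show ?thesis by (simp add: integrable_continuous_real)
qed

lemma curve_length_nonneg: "curve_length g \<gamma> \<ge> 0"
  unfolding curve_length_def
  by (cases "curve_speed g \<gamma> integrable_on {0..1}")
    (auto intro!: integral_nonneg simp: curve_speed_conformal not_integrable_integral)

lemma riemannian_dist_le_linepath:
  "riemannian_dist g a b \<le> integral {0..1} (\<lambda>t. exp (f (linepath a b t)) * norm (b - a))"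
proof -
  have "riemannian_dist g a b \<le> curve_length g (linepath a b)"
    unfolding riemannian_dist_def
  proof (rule cInf_lower)
    show "curve_length g (linepath a b) \<in> {curve_length g \<gamma> | \<gamma>. valid_path \<gamma> \<and> pathstart \<gamma> = a \<and> pathfinish \<gamma> = b \<and>
                                  curve_speed g \<gamma> integrable_on {0..1}}"
      using linepath_speed_integrable by auto
  qed (auto intro!: bdd_belowI[of _ 0] curve_length_nonneg)
  also have "curve_length g (linepath a b) = integral {0..1} (\<lambda>t. exp (f (linepath a b t)) * norm (b - a))"
    unfolding curve_length_def using linepath_speed by presburger
  finally show ?thesis .
qed

text \<open>
  After the last time at which the curve is at Euclidean distance at least \<open>1\<close> from \<open>x\<close>, it stays
  in the unit ball, where \<open>g\<close> dominates \<open>c\<^sup>2\<close> times the Euclidean metric, and it still has to cover the distance \<open>1\<close>.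
\<close>

lemma curve_length_leaving_ball:
  assumes \<gamma>: "valid_path \<gamma>" "pathfinish \<gamma> = x" "curve_speed g \<gamma> integrable_on {0..1}"
    and far: "norm (pathstart \<gamma> - x) \<ge> 1"
    and c: "c > 0" "\<And>y. norm (y - x) \<le> 1 \<Longrightarrow> c \<le> exp (f y)"
  shows "c \<le> curve_length g \<gamma>"
proof -
  have cont\<gamma>: "continuous_on {0..1} \<gamma>"
    using valid_path_imp_path[OF \<gamma>(1)] by (simp add: path_def)
  define T where "T = {t \<in> {0..1}. norm (\<gamma> t - x) \<ge> 1}"
  have "closed T"
  proof -
    have "continuous_on {0..1} (\<lambda>t. norm (\<gamma> t - x))" by (intro continuous_intros cont\<gamma>)
    then have "closedin (top_of_set {0..1}) ({0..1} \<inter> (\<lambda>t. norm (\<gamma> t - x)) -` {1..})"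
      by (rule continuous_closedin_preimage) auto
    moreover have "{0..1} \<inter> (\<lambda>t. norm (\<gamma> t - x)) -` {1..} = T" by (auto simp: T_def)
    ultimately show ?thesis using closedin_closed_trans by (metis closed_atLeastAtMost)
  qed
  moreover have "bounded T" by (rule bounded_subset[of "{0..1}"]) (auto simp: T_def)
  ultimately have "compact T" by (simp add: compact_eq_bounded_closed)
  moreover have "0 \<in> T" using far by (simp add: T_def pathstart_def)
  ultimately obtain t0 where t0: "t0 \<in> T" "\<And>t. t \<in> T \<Longrightarrow> t \<le> t0"
    using compact_attains_sup[of T] by blast
  have t01: "0 \<le> t0" "t0 \<le> 1" "norm (\<gamma> t0 - x) \<ge> 1" using t0(1) by (auto simp: T_def)
  have inside: "norm (\<gamma> t - x) \<le> 1" if "t \<in> {t0<..1}" for t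
  proof (rule ccontr)
    assume "\<not> norm (\<gamma> t - x) \<le> 1"
    then have "t \<in> T" using that t01 by (auto simp: T_def)
    then show False using t0(2)[of t] that by simp
  qed
  obtain S where S: "finite S" and C1: "\<gamma> C1_differentiable_on ({0..1} - S)"
    using \<gamma>(1) by (auto simp: valid_path_def piecewise_C1_differentiable_on_def)
  have vd: "(\<gamma> has_vector_derivative vector_derivative \<gamma> (at t)) (at t)" if "t \<in> {0..1} - S" for t
    using C1 that unfolding C1_differentiable_on_def by (metis vector_derivative_at)
  have hi: "((\<lambda>t. vector_derivative \<gamma> (at t)) has_integral (\<gamma> 1 - \<gamma> t0)) {t0..1}"
    by (rule fundamental_theorem_of_calculus_strong[OF S t01(2)])
      (use t01 vd in \<open>auto intro: continuous_on_subset[OF cont\<gamma>]\<close>)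
  have int: "curve_speed g \<gamma> integrable_on {t0..1}"
    by (rule integrable_on_subinterval[OF \<gamma>(3)]) (use t01 in auto)
  have "c \<le> c * norm (\<gamma> t0 - x)" using c t01 by simp
  also have "\<dots> = norm (c *\<^sub>R (\<gamma> 1 - \<gamma> t0))"
    using c \<gamma>(2) by (simp add: pathfinish_def norm_minus_commute)
  also have "\<dots> = norm (integral {t0..1} (\<lambda>t. c *\<^sub>R vector_derivative \<gamma> (at t)))"
    by (simp only: integral_unique[OF has_integral_cmul[OF hi, of c]])
  also have "\<dots> \<le> integral {t0..1} (curve_speed g \<gamma>)"
  proof -
    \<comment> \<open>The speed is bounded below only after the time \<open>t0\<close>; the integrand is changed at that
    single point.\<close>
    have "norm (integral {t0..1} (\<lambda>t. if t = t0 then 0 else c *\<^sub>R vector_derivative \<gamma> (at t))) \<le> integral {t0..1} (curve_speed g \<gamma>)"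
    proof (rule integral_norm_bound_integral[OF _ int])
      show "(\<lambda>t. if t = t0 then 0 else c *\<^sub>R vector_derivative \<gamma> (at t)) integrable_on {t0..1}"
        by (rule integrable_spike_finite[of "{t0}", OF _ _ has_integral_integrable[OF has_integral_cmul[OF hi, of c]]]) auto
      show "norm (if t = t0 then 0 else c *\<^sub>R vector_derivative \<gamma> (at t)) \<le> curve_speed g \<gamma> t" if "t \<in> {t0..1}" for t
        using inside[of t] c(1) c(2)[of "\<gamma> t"] that
        by (auto simp: curve_speed_conformal intro!: mult_right_mono)
    qed
    moreover have "integral {t0..1} (\<lambda>t. if t = t0 then 0 else c *\<^sub>R vector_derivative \<gamma> (at t)) =
        integral {t0..1} (\<lambda>t. c *\<^sub>R vector_derivative \<gamma> (at t))"
      by (rule integral_spike[of "{t0}"]) auto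
    ultimately show ?thesis by simp
  qed
  also have "\<dots> \<le> integral {0..1} (curve_speed g \<gamma>)"
    by (rule integral_subset_le[OF _ int \<gamma>(3)]) (use t01 in \<open>auto simp: curve_speed_conformal\<close>)
  finally show ?thesis by (simp add: curve_length_def)
qed

text \<open>
  Convergence in the Riemannian distance thus forces points into the Euclidean unit ball, so an
  unbounded sequence along a ray has no limit.
\<close>

lemma riemannian_dist_outside_ball:
  "\<exists>c>0. \<forall>y. norm (y - x) \<ge> 1 \<longrightarrow> c \<le> riemannian_dist g y x"
proof -
  have "continuous_on (cball x 1) (\<lambda>y. exp (f y))"
    by (intro continuous_intros continuous_on_subset[OF cont]) auto
  then obtain y0 where y0: "\<And>y. y \<in> cball x 1 \<Longrightarrow> exp (f y0) \<le> exp (f y)"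
    using continuous_attains_inf[OF compact_cball, of x 1 "\<lambda>y. exp (f y)"] by force
  have "exp (f y0) \<le> riemannian_dist g y x" if far: "norm (y - x) \<ge> 1" for y
    unfolding riemannian_dist_def
  proof (rule cInf_greatest)
    show "{curve_length g \<gamma> | \<gamma>. valid_path \<gamma> \<and> pathstart \<gamma> = y \<and> pathfinish \<gamma> = x \<and>
                                  curve_speed g \<gamma> integrable_on {0..1}} \<noteq> {}"
      using linepath_speed_integrable[of y x] valid_path_linepath[of y x] by fastforce
    fix l assume "l \<in> {curve_length g \<gamma> | \<gamma>. valid_path \<gamma> \<and> pathstart \<gamma> = y \<and> pathfinish \<gamma> = x \<and>
                                  curve_speed g \<gamma> integrable_on {0..1}}"
    then show "exp (f y0) \<le> l"
      using curve_length_leaving_ball[of _ x "exp (f y0)"] y0 far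
      by (auto simp: dist_norm norm_minus_commute simp del: exp_le_cancel_iff)
  qed
  then show ?thesis by (intro exI[of _ "exp (f y0)"]) simp
qed

text \<open>
  The function \<open>L\<close> is the tail of the integral that bounds the length of the ray. It tends to \<open>0\<close>, so the points
  at parameters \<open>T + k\<close> form a Cauchy sequence; they leave every bounded set because \<open>y \<noteq> 0\<close>.
\<close>

lemma short_ray_not_complete:
  assumes y: "y \<noteq> 0" and T: "T > 0" and a: "a > 1"
    and decay: "\<And>t. t \<ge> T \<Longrightarrow> exp (f (x0 + t *\<^sub>R y)) \<le> K * t powr (- a)"
  shows "\<not> complete_metric g"
proof
  assume complete: "complete_metric g"
  define L where "L t = K * norm y / (a - 1) * t powr (1 - a)" for t
  have dist: "riemannian_dist g (x0 + s *\<^sub>R y) (x0 + t *\<^sub>R y) \<le> \<bar>L s - L t\<bar>" if st: "s \<ge> T" "t \<ge> T" for s t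
  proof -
    let ?h = "\<lambda>u. exp (f (linepath (x0 + s *\<^sub>R y) (x0 + t *\<^sub>R y) u)) * norm ((x0 + t *\<^sub>R y) - (x0 + s *\<^sub>R y))"
    define r where "r u = (1 - u) * s + u * t" for u
    have lp: "linepath (x0 + s *\<^sub>R y) (x0 + t *\<^sub>R y) u = x0 + r u *\<^sub>R y" for u
      by (simp add: linepath_def r_def algebra_simps)
    have rT: "r u \<ge> T" if "u \<in> {0..1}" for u
      unfolding r_def using convex_bound_le[of "-s" "-T" "-t" "1-u" u] st that by simp
    have n: "norm ((x0 + t *\<^sub>R y) - (x0 + s *\<^sub>R y)) = \<bar>t - s\<bar> * norm y"
      by (simp add: scaleR_diff_left[symmetric])
    \<comment> \<open>The sign treats both orders of \<open>s\<close> and \<open>t\<close> at once.\<close>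
    define \<sigma> where "\<sigma> = sgn (t - s)"
    have sg: "\<sigma> * (t - s) = \<bar>t - s\<bar>" by (simp add: \<sigma>_def abs_sgn mult.commute)
    have hi: "((\<lambda>u. K * r u powr (- a) * (\<bar>t - s\<bar> * norm y)) has_integral (- \<sigma> * L (r 1) - - \<sigma> * L (r 0))) {0..1}"
    proof (rule fundamental_theorem_of_calculus)
      fix u :: real assume u: "u \<in> {0..1}"
      have pos: "r u > 0" using rT[OF u] T by simp
      have "(r has_real_derivative (t - s)) (at u)"
        unfolding r_def by (auto intro!: derivative_eq_intros)
      from has_real_derivative_powr'[OF this DERIV_const[of "1 - a"] pos]
      have "((\<lambda>u. r u powr (1 - a)) has_real_derivative (1 - a) * r u powr (- a) * (t - s)) (at u)"
        using pos by (auto simp: powr_diff powr_minus field_simps elim!: DERIV_cong)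
      from DERIV_cmult[OF this, of "- \<sigma> * (K * norm y / (a - 1))"]
      have "((\<lambda>u. - \<sigma> * L (r u)) has_real_derivative K * r u powr (- a) * (\<bar>t - s\<bar> * norm y)) (at u)"
        unfolding L_def sg[symmetric] using a by (auto simp: field_simps elim!: DERIV_cong)
      then show "((\<lambda>u. - \<sigma> * L (r u)) has_vector_derivative K * r u powr (- a) * (\<bar>t - s\<bar> * norm y)) (at u within {0..1})"
        by (simp add: has_real_derivative_iff_has_vector_derivative has_vector_derivative_at_within)
    qed simp
    have "riemannian_dist g (x0 + s *\<^sub>R y) (x0 + t *\<^sub>R y) \<le> integral {0..1} ?h"
      by (rule riemannian_dist_le_linepath)
    also have "\<dots> \<le> integral {0..1} (\<lambda>u. K * r u powr (- a) * (\<bar>t - s\<bar> * norm y))"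
    proof (rule integral_le)
      show "?h integrable_on {0..1}"
        by (intro integrable_continuous_real continuous_intros continuous_on_compose2[OF cont]) auto
      show "(\<lambda>u. K * r u powr (- a) * (\<bar>t - s\<bar> * norm y)) integrable_on {0..1}" using hi by blast
      show "?h u \<le> K * r u powr (- a) * (\<bar>t - s\<bar> * norm y)" if "u \<in> {0..1}" for u
        unfolding lp n using decay[OF rT[OF that]] by (intro mult_right_mono) auto
    qed
    also have "\<dots> = \<sigma> * (L s - L t)" using integral_unique[OF hi] by (simp add: r_def algebra_simps)
    also have "\<dots> \<le> \<bar>L s - L t\<bar>" by (auto simp: \<sigma>_def sgn_if)
    finally show ?thesis .
  qed
  define \<sigma> where "\<sigma> k = x0 + (T + real k) *\<^sub>R y" for k :: nat
  have lim: "(\<lambda>k. L (T + real k)) \<longlonglongrightarrow> 0"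
  proof -
    have "((\<lambda>t. t powr (1 - a)) \<longlongrightarrow> 0) at_top" using a by (intro tendsto_neg_powr filterlim_ident) auto
    moreover have "filterlim (\<lambda>k. T + real k) at_top sequentially"
      by (intro filterlim_tendsto_add_at_top[OF tendsto_const] filterlim_real_sequentially)
    ultimately have "(\<lambda>k. (T + real k) powr (1 - a)) \<longlonglongrightarrow> 0" by (rule filterlim_compose)
    from tendsto_mult_right_zero[OF this, of "K * norm y / (a - 1)"] show ?thesis by (simp add: L_def)
  qed
  have "\<exists>N. \<forall>m\<ge>N. \<forall>k\<ge>N. riemannian_dist g (\<sigma> m) (\<sigma> k) < \<epsilon>" if "\<epsilon> > 0" for \<epsilon> :: real
  proof -
    have "Cauchy (\<lambda>k. L (T + real k))" using lim by (intro LIMSEQ_imp_Cauchy)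
    then obtain N where N: "\<And>m k. m \<ge> N \<Longrightarrow> k \<ge> N \<Longrightarrow> dist (L (T + real m)) (L (T + real k)) < \<epsilon>"
      using metric_CauchyD[OF _ \<open>\<epsilon> > 0\<close>] by meson
    have "riemannian_dist g (\<sigma> m) (\<sigma> k) < \<epsilon>" if "m \<ge> N" "k \<ge> N" for m k
      using dist[of "T + real m" "T + real k"] N[OF that] by (simp add: \<sigma>_def dist_real_def)
    then show ?thesis by blast
  qed
  then obtain x where x: "(\<lambda>k. riemannian_dist g (\<sigma> k) x) \<longlonglongrightarrow> 0"
    using complete unfolding complete_metric_def by blast
  obtain c where c: "c > 0" "\<And>z. norm (z - x) \<ge> 1 \<Longrightarrow> c \<le> riemannian_dist g z x"
    using riemannian_dist_outside_ball by blast
  have "eventually (\<lambda>k. riemannian_dist g (\<sigma> k) x < c) sequentially"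
    using order_tendstoD(2)[OF x c(1)] .
  moreover have "eventually (\<lambda>k. real k \<ge> (1 + norm (x - x0)) / norm y) sequentially"
    using eventually_ge_at_top filterlim_real_sequentially unfolding filterlim_at_top by blast
  ultimately have "eventually (\<lambda>k. False) sequentially"
  proof eventually_elim
    case (elim k)
    have "1 + norm (x - x0) \<le> real k * norm y" using elim(2) y by (simp add: divide_simps)
    also have "\<dots> \<le> (T + real k) * norm y" using T by (intro mult_right_mono) auto
    also have "\<dots> = norm (\<sigma> k - x0)" using T by (simp add: \<sigma>_def)
    also have "\<dots> \<le> norm (\<sigma> k - x) + norm (x - x0)" using norm_triangle_ineq[of "\<sigma> k - x" "x - x0"] by simp
    finally show False using c(2)[of "\<sigma> k"] elim(1) by simp
  qed
  then show False by simp
qed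

end

section \<open>Rigidity\<close>

lemma smooth_scaleR: "smooth (\<lambda>x::'a::euclidean_space. c *\<^sub>R x)"
proof -
  have const: "Ck k (\<lambda>x::'a. w)" for k and w :: 'a
  proof (induction k arbitrary: w)
    case (Suc k)
    have "frechet_derivative (\<lambda>x::'a. w) (at x) = (\<lambda>v. 0)" for x
      by (rule frechet_derivative_at[symmetric]) simp
    then show ?case using Suc by (simp add: Ck.simps)
  qed (simp add: Ck.simps)
  have "Ck k (\<lambda>x::'a. c *\<^sub>R x)" for k
  proof (cases k)
    case (Suc k)
    have "((\<lambda>x::'a. c *\<^sub>R x) has_derivative (\<lambda>v. c *\<^sub>R v)) (at x)" for x
      by (auto intro!: derivative_eq_intros)
    from frechet_derivative_at[OF this, symmetric]
    have "frechet_derivative (\<lambda>x::'a. c *\<^sub>R x) (at x) = (\<lambda>v. c *\<^sub>R v)" for x .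
    then show ?thesis using const by (simp add: Suc Ck.simps)
  qed (auto simp: Ck.simps intro!: continuous_intros)
  then show ?thesis by (simp add: smooth_def)
qed

lemma isometric_std_of_constant_factor:
  fixes g :: "real^'n::finite \<Rightarrow> real^'n^'n"
  assumes g: "\<And>x. g x = exp (2 * c) *\<^sub>R mat 1"
  shows "isometric g std_metric"
proof -
  define \<phi> where "\<phi> x = exp c *\<^sub>R x" for x :: "real^'n"
  have inv: "inv \<phi> = (\<lambda>x. exp (- c) *\<^sub>R x)"
    by (rule inv_equality) (auto simp: \<phi>_def exp_minus)
  have "bij \<phi>"
    by (rule bij_betw_byWitness[where f'="\<lambda>x. exp (- c) *\<^sub>R x"]) (auto simp: \<phi>_def exp_minus)
  then have "diffeomorphism \<phi>"
    unfolding diffeomorphism_def inv using smooth_scaleR[of "exp c"] smooth_scaleR[of "exp (- c)"]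
    by (simp add: \<phi>_def[abs_def])
  moreover have "frechet_derivative \<phi> (at x) = (\<lambda>v. exp c *\<^sub>R v)" for x
    unfolding \<phi>_def[abs_def]
    by (rule frechet_derivative_at[symmetric]) (auto intro!: derivative_eq_intros)
  ultimately show ?thesis
    unfolding isometric_def
    by (intro exI[of _ \<phi>]) (simp add: std_metric_def g scaleR_matrix_vector_assoc[symmetric] exp_double power2_eq_square)
qed

theorem theorem1:
  fixes g :: "real^'n::finite \<Rightarrow> real^'n^'n" and \<tau> :: real
  assumes "CARD('n) \<ge> 3"
    and "riemannian_metric g"
    and "complete_metric g"
    and "conformal_to g std_metric"
    and "0 < \<tau>" and "\<tau> < 2 * (real CARD('n) - 1) / real CARD('n)"
    and "\<forall>x. pos_semidef (modified_schouten \<tau> g x)"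
  shows "isometric g std_metric"
proof -
  obtain f where "smooth f" and "\<forall>x. g x = exp (2 * f x) *\<^sub>R std_metric x"
    using assms(4) unfolding conformal_to_def by blast
  then have C2: "C2 f" and g: "g x = exp (2 * f x) *\<^sub>R mat 1" for x
    by (auto simp: smooth_imp_C2 std_metric_def)
  define N where "N = real DIM(real^'n)"
  have N_card: "real CARD('n) = N" by (simp add: N_def)
  have N: "N \<ge> 3" using assms(1) by (simp add: N_def)
  have pinch: "0 \<le> - (N - 2) * (dderiv v (dderiv v f) x - (dderiv v f x)\<^sup>2)
      - ((1 - \<tau>) * laplacian f x + (N - 2) * (1 - \<tau> / 2) * (norm (grad f x))\<^sup>2)"
    if "norm v = 1" for v x
  proof -
    have "0 \<le> v \<bullet> (modified_schouten \<tau> g x *v v)"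
      using assms(7) by (simp add: pos_semidef_def)
    moreover have "v \<bullet> v = 1" using that by (simp add: norm_eq_1)
    ultimately show ?thesis
      using modified_schouten_quadratic_form[OF C2 g, of v \<tau> x] assms(1) by (simp add: N_card)
  qed
  have \<tau>: "\<tau> < 2 * (N - 1) / N" using assms(6) by (simp add: N_card)
  have lap: "laplacian f x \<le> - (norm (grad f x))\<^sup>2 / 2" for x
  proof -
    have "laplacian f x \<le> - (N - 2) / 2 * (norm (grad f x))\<^sup>2"
      using laplacian_le_of_pinching[OF C2 _ assms(5), of x] N \<tau> pinch unfolding N_def by blast
    also have "\<dots> \<le> - 1 / 2 * (norm (grad f x))\<^sup>2" using N by (intro mult_right_mono) auto
    finally show ?thesis by simp
  qed
  have "f x0 \<le> f x1" for x0 x1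
  proof (rule ccontr)
    assume "\<not> f x0 \<le> f x1"
    then have nonconst: "f x1 < f x0" by simp
    \<comment> \<open>The subsolution property needs a positive coefficient \<open>1 - \<theta>\<close> of the Laplacian.\<close>
    define \<theta> where "\<theta> = min \<tau> (1/2)"
    have \<theta>: "0 < \<theta>" "\<theta> < 1" "\<theta> \<le> \<tau>" using assms(5) by (auto simp: \<theta>_def)
    have "0 \<le> - (N - 2) * (dderiv v (dderiv v f) x - (dderiv v f x)\<^sup>2)
      - ((1 - \<theta>) * laplacian f x + (N - 2) * (1 - \<theta> / 2) * (norm (grad f x))\<^sup>2)"
      if "norm v = 1" for v x
      using pinching_weaken[OF C2 _ assms(5), of x v \<theta>] N \<tau> pinch that \<theta>(3) unfolding N_def by blast
    then obtain T K where T: "T \<ge> 1" and K: "K \<ge> 0"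
      and decay: "\<And>t. t \<ge> T \<Longrightarrow> \<exists>z. norm (z - x0) = t \<and> exp (f z / 4) \<le> K * t powr (-3/8)"
      using conformal_factor_decay[OF C2 _ \<theta>(1,2) _ nonconst] N unfolding N_def by blast
    obtain y K' where "y \<noteq> 0" "\<And>t. t \<ge> T \<Longrightarrow> exp (f (x0 + t *\<^sub>R y)) \<le> K' * t powr (-5/4)"
      using exists_thin_ray[OF C2 lap T K decay] by blast
    then have "\<not> complete_metric g"
      using short_ray_not_complete[OF C2_continuous(1)[OF C2] g, of y T "5/4" x0 K'] T by simp
    then show False using assms(3) by blast
  qed
  then have "f x = f 0" for x by (simp add: order_antisym)
  then have "g x = exp (2 * f 0) *\<^sub>R mat 1" for x using g by metis
  then show ?thesis by (rule isometric_std_of_constant_factor)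
qed

end
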